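(* Let $k\ge 4$, $m\ge k$, and $b$ an integer with $k-2\le b\le \frac{km-4k+4}{k-2}$ and $k(m-b)$ even. Define $$f(k,m,b)(q)=\binom{m}{k}_q-q^{\frac{k(m-b)}{2}+b-2k+2}\binom{b}{k-2}_q .$$ If $f(k,m,b)$ is nonnegative and unimodal, then $f(k,m,b-(2k-6))$ is also nonnegative and unimodal.
   Context: For integers $m\ge k\ge 0$ the $q$-binomial coefficient is $\binom{m}{k}_q=\prod_{i=1}^{m}(1-q^i)\big/\big(\prod_{i=1}^{k}(1-q^i)\prod_{i=1}^{m-k}(1-q^i)\big)$; by convention $\binom{n}{j}_q=0$ if $n<j$. A polynomial is nonnegative if all its coefficients are $\ge 0$, and unimodal if its coefficient sequence weakly increases up to some index and weakly decreases afterwards. *)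

theory Defs
  imports "HOL-Computational_Algebra.Polynomial"
begin

definition q_prod :: "nat \<Rightarrow> int poly" where
  "q_prod n = (\<Prod>i = 1..n. 1 - monom 1 i)"

text \<open>
  The upper argument is an integer, so that the convention that the coefficient vanishes for
  \<open>n < j\<close> also covers negative \<open>n\<close>. The division is exact in \<^typ>\<open>int poly\<close>,
  see \<open>q_binomial_mult\<close> below.
\<close>

definition q_binomial :: "int \<Rightarrow> nat \<Rightarrow> int poly" where
  "q_binomial n j =
     (if n < int j then 0
      else q_prod (nat n) div (q_prod j * q_prod (nat n - j)))"

definition nonneg_poly :: "int poly \<Rightarrow> bool" where
  "nonneg_poly p \<longleftrightarrow> (\<forall>i. coeff p i \<ge> 0)"

definition unimodal_poly :: "int poly \<Rightarrow> bool" where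
  "unimodal_poly p \<longleftrightarrow>
     (\<exists>N \<le> degree p. mono_on {0..N} (coeff p) \<and> antimono_on {N..degree p} (coeff p))"

text \<open>
  When \<open>k * (m - b)\<close> is even and \<open>b \<le> (k * m - 4 * k + 4) / (k - 2)\<close>, the division by 2 is
  exact and the exponent is a nonnegative integer, also with \<open>b - (2 * k - 6)\<close> in place of \<open>b\<close>;
  hence neither \<^term>\<open>(div)\<close> nor \<^const>\<open>nat\<close> truncates.
\<close>

definition f_poly :: "nat \<Rightarrow> nat \<Rightarrow> int \<Rightarrow> int poly" where
  "f_poly k m b =
     q_binomial (int m) k
     - monom 1 (nat (int k * (int m - b) div 2 + b - 2 * int k + 2)) * q_binomial b (k - 2)"

lemma q_prod_Suc: "q_prod (Suc n) = q_prod n * (1 - monom 1 (Suc n))"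
  by (simp add: q_prod_def)

lemma q_prod_0 [simp]: "q_prod 0 = 1"
  by (simp add: q_prod_def)

lemma q_prod_nonzero: "q_prod n \<noteq> 0"
proof -
  have "1 - monom 1 i \<noteq> (0 :: int poly)" if "i \<ge> 1" for i :: nat
  proof
    assume "1 - monom 1 i = (0 :: int poly)"
    then have "coeff (1 - monom 1 i :: int poly) 0 = 0" by simp
    with that show False by simp
  qed
  then show ?thesis by (auto simp: q_prod_def)
qed

lemma q_prod_mult_dvd: "q_prod j * q_prod l dvd q_prod (j + l)"
proof (induction "j + l" arbitrary: j l)
  case 0
  then show ?case by simp
next
  case (Suc n)
  show ?case
  proof (cases "j = 0 \<or> l = 0")
    case True
    then show ?thesis by auto
  next
    case False
    then obtain j' l' where jl: "j = Suc j'" "l = Suc l'"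
      by (metis not0_implies_Suc)
    let ?x = "monom 1 :: nat \<Rightarrow> int poly"
    have 1: "q_prod j' * q_prod l dvd q_prod n"
      using Suc.hyps(1)[of j' l] Suc.hyps(2) jl by simp
    have 2: "q_prod j * q_prod l' dvd q_prod n"
      using Suc.hyps(1)[of j l'] Suc.hyps(2) jl by simp
    have "?x (j + l) = ?x j * ?x l"
      by (simp add: mult_monom)
    then have "q_prod (j + l) = q_prod n * (1 - ?x j) + ?x j * (q_prod n * (1 - ?x l))"
      using Suc.hyps(2) q_prod_Suc[of n] by (simp add: algebra_simps)
    moreover have "q_prod j * q_prod l dvd q_prod n * (1 - ?x j)"
      using mult_dvd_mono[OF 1 dvd_refl[of "1 - ?x j"]] q_prod_Suc[of j'] jl(1)
      by (simp add: mult_ac)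
    moreover have "q_prod j * q_prod l dvd q_prod n * (1 - ?x l)"
      using mult_dvd_mono[OF 2 dvd_refl[of "1 - ?x l"]] q_prod_Suc[of l'] jl(2)
      by (simp add: mult_ac)
    ultimately show ?thesis by simp
  qed
qed

lemma q_binomial_mult:
  assumes "j \<le> n"
  shows "q_binomial (int n) j * (q_prod j * q_prod (n - j)) = q_prod n"
  using assms q_prod_mult_dvd[of j "n - j"] by (simp add: q_binomial_def)

end

theory Submission
  imports Defs "HOL-Library.Poly_Mapping"
begin

text \<open>
  Put \<open>j = k - 2\<close>. Then \<open>f(k,m,b-(2k-6)) - f(k,m,b)\<close> is a power of \<open>q\<close> times
  \<open>[b, j] - q^(j(j-1)) [b-2(j-1), j]\<close>, and all these polynomials are palindromic about the same
  centre, so it suffices that the latter difference is nonnegative and unimodal.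

  The Lie algebra \<open>sl2\<close> acts by derivations on the polynomials in the coefficients
  \<open>X_0, \<dots>, X_j\<close> of a binary form of degree \<open>j\<close>; the space of polynomials of degree \<open>a\<close>
  and weight \<open>d\<close> has dimension the coefficient of \<open>q^d\<close> in \<open>[a+j, j]\<close>. Multiplication by a
  nonzero \<open>sl2\<close>-invariant of degree \<open>2(j-1)\<close> (and hence weight \<open>j(j-1)\<close>) embeds
  the polynomials of degree \<open>a-2(j-1)\<close> equivariantly into those of degree \<open>a\<close>, and the quotient
  representation has the difference as its character. The discriminant is such an invariant; more
  elementary ones are powers of the quadratic invariant for even \<open>j\<close>, and for odd \<open>j\<close> powers of
  the quartic invariant that is the discriminant of the quadratic covariant.
\<close>

alias lookup = Poly_Mapping.lookup
alias single = Poly_Mapping.single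
alias keys = Poly_Mapping.keys

subsection \<open>Linear algebra and derivations of multivariate polynomials\<close>

text \<open>A complement of \<open>span B0\<close> in \<open>span T0\<close> is mapped injectively
  by \<open>f\<close>, and its image meets \<open>span B1\<close> only in 0. This compares the
  dimensions of the two quotients, arranged without subtraction.\<close>

lemma (in vector_space) card_quotient_le:
  assumes add: "\<And>x y. f (x + y) = f x + f y" and scale: "\<And>c x. f (c *s x) = c *s f x"
    and T0: "finite T0" "independent T0" and T1: "finite T1"
    and B0: "independent B0" "B0 \<subseteq> span T0" and B1: "independent B1" "B1 \<subseteq> span T1"
    and f: "\<And>x. x \<in> span T0 \<Longrightarrow> f x \<in> span T1"
    and inj: "\<And>x. x \<in> span T0 \<Longrightarrow> f x \<in> span B1 \<Longrightarrow> x \<in> span B0"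
  shows "card T0 + card B1 \<le> card T1 + card B0"
proof -
  have lin: "Vector_Spaces.linear (*s) (*s) f"
    by unfold_locales (auto simp: add scale)
  interpret f: Vector_Spaces.linear "(*s)" "(*s)" f by (rule lin)
  obtain B where B: "B0 \<subseteq> B" "B \<subseteq> span T0" "independent B" "span T0 \<subseteq> span B"
    using maximal_independent_subset_extend[OF B0(2,1)] by metis
  have finB: "finite B" "card B \<le> card T0"
    using independent_span_bound[OF T0(1) B(3,2)] by auto
  have "card T0 \<le> card B"
    using independent_span_bound[OF finB(1) T0(2)] B(4) span_superset[of T0] by auto
  then have cB: "card B = card T0" using finB by simp
  have fB1: "finite B1" using independent_span_bound[OF T1 B1] by auto
  \<comment> \<open>\<open>B\<close> extends \<open>B0\<close> to a basis of \<open>span T0\<close>,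
    so \<open>C\<close> is a basis of a complement of \<open>span B0\<close>.\<close>
  define C where "C = B - B0"
  have "finite S \<Longrightarrow> S \<subseteq> C \<Longrightarrow> independent (f ` S \<union> B1) \<and> card (f ` S \<union> B1)
    = card S + card B1" for S
  proof (induction S rule: finite_induct)
    case empty
    then show ?case using B1 by simp
  next
    case (insert c S)
    have notin: "f c \<notin> span (f ` S \<union> B1)"
    proof
      assume "f c \<in> span (f ` S \<union> B1)"
      then obtain u z where uz: "f c = u + z" "u \<in> span (f ` S)" "z \<in> span B1"
        unfolding span_Un by auto
      then obtain y where y: "y \<in> span S" "u = f y"
        using f.span_image[of S] by auto
      have S: "S \<subseteq> B" "c \<in> B" "c \<notin> B0" "S \<inter> B0 = {}"
        using insert.prems C_def by auto
      \<comment> \<open>Now \<open>f (c - y) = z\<close> lies in \<open>span B1\<close>, so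
        \<open>inj\<close> puts \<open>c - y\<close> in \<open>span B0\<close> and makes
        \<open>c\<close> a combination of other elements of the basis \<open>B\<close>.\<close>
      have "c - y \<in> span T0"
      proof (rule span_diff)
        show "c \<in> span T0" using S(2) B(2) by blast
        have "S \<subseteq> span T0" using S(1) B(2) by blast
        from span_mono[OF this] y(1) show "y \<in> span T0" by (auto simp only: span_span)
      qed
      moreover have "f (c - y) \<in> span B1"
        using uz y by (simp add: f.diff)
      ultimately have "c - y \<in> span B0" by (rule inj)
      then have "y + (c - y) \<in> span (S \<union> B0)"
        unfolding span_Un using y(1) by blast
      then have "c \<in> span (S \<union> B0)" by simp
      moreover have "S \<union> B0 \<subseteq> B - {c}" using S B(1) insert.hyps by auto
      ultimately have "c \<in> span (B - {c})" using span_mono by blast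
      then show False using B(3) S(2) dependent_def by blast
    qed
    have "f c \<notin> f ` S \<union> B1" using notin span_superset[of "f ` S \<union> B1"] by (rule contra_subsetD[rotated])
    then have "card (insert (f c) (f ` S \<union> B1)) = Suc (card (f ` S \<union> B1))"
      using insert.hyps(1) fB1 by simp
    moreover have "independent (f ` S \<union> B1)" "card (f ` S \<union> B1) = card S + card B1"
      using insert.IH insert.prems by auto
    ultimately show ?case using independent_insertI[OF notin] insert.hyps by simp
  qed
  from this[of C] have ind: "independent (f ` C \<union> B1)" and cd: "card (f ` C \<union> B1) = card C + card B1"
    using finB C_def by auto
  have "f ` C \<union> B1 \<subseteq> span T1"
    using f B(2) B1 C_def by auto
  then have "card C + card B1 \<le> card T1"
    using independent_span_bound[OF T1 ind] cd by auto
  moreover have "card C = card B - card B0" "card B0 \<le> card B"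
    using B(1) finB C_def by (simp_all add: card_Diff_subset finite_subset card_mono)
  ultimately show ?thesis using cB by simp
qed

section \<open>Real polynomials in X_0, X_1, ... and their derivations\<close>

type_synonym mpoly = "(nat \<Rightarrow>\<^sub>0 nat) \<Rightarrow>\<^sub>0 real"

definition Var :: "nat \<Rightarrow> mpoly" where
  "Var i = single (single i 1) 1"

abbreviation "Con c \<equiv> (single 0 c :: mpoly)"

lemma poly_mapping_sum_single:
  "p = (\<Sum>e\<in>keys p. single e (lookup p e))"
  by (rule poly_mapping_eqI)
    (auto simp: lookup_sum lookup_single when_def sum.delta in_keys_iff cong: if_cong)

lemma poly_mapping_single_induct:
  assumes "\<And>e c. P (single e c)" "\<And>p q. P p \<Longrightarrow> P q \<Longrightarrow> P (p + q)"
  shows "P (p :: 'a \<Rightarrow>\<^sub>0 'b::comm_monoid_add)"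
proof -
  have 0: "P 0" using assms(1)[of undefined 0] by simp
  have "P (\<Sum>e\<in>A. single e (lookup p e))" if "finite A" for A
    using that by (induction rule: finite_induct) (auto intro: 0 assms)
  from this[of "keys p"] show ?thesis
    using poly_mapping_sum_single[of p] by simp
qed

lemma mpoly_induct:
  fixes P :: "mpoly \<Rightarrow> bool"
  assumes con: "\<And>c. P (Con c)" and var: "\<And>i. P (Var i)"
    and add: "\<And>p q. P p \<Longrightarrow> P q \<Longrightarrow> P (p + q)" and mult: "\<And>p q. P p \<Longrightarrow> P q \<Longrightarrow> P (p * q)"
  shows "P p"
proof (induction p rule: poly_mapping_single_induct)
  case (1 e c)
  have "P (single e 1)"
  proof (induction e rule: poly_mapping_single_induct)
    case (1 i n)
    show ?case
    proof (induction n)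
      case 0
      then show ?case using con[of 1] by simp
    next
      case (Suc n)
      have "single (single i (Suc n)) 1
        = Var i * single (single i n) 1"
        by (simp add: Var_def mult_single flip: single_add)
      then show ?case using mult[OF var Suc] by simp
    qed
  next
    case (2 e f)
    then show ?case using mult[OF 2] by (simp add: mult_single)
  qed
  from mult[OF con[of c] this] show ?case by (simp add: mult_single)
qed (rule add)

text \<open>Given by coefficients: the one at X^e comes from the monomial X_i X^e alone. Shifting
  exponents up avoids truncated subtraction, and injectivity of the shift keeps the support
  finite.\<close>

lift_definition partial_deriv :: "nat \<Rightarrow> mpoly \<Rightarrow> mpoly" is
  "\<lambda>i p e. of_nat (lookup e i + 1) * p (e + single i 1)"
proof -
  fix i :: nat and p :: "(nat \<Rightarrow>\<^sub>0 nat) \<Rightarrow> real"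
  assume "finite {e. p e \<noteq> 0}"
  then have "finite ((\<lambda>e. e + single i 1) -` {e. p e \<noteq> 0})"
    by (intro finite_vimageI) (auto intro: injI)
  then show "finite {e. of_nat (lookup e i + 1) * p (e + single i 1) \<noteq> 0}"
    by (rule rev_finite_subset) auto
qed

lemma exponent_diff_single_eq_iff:
  fixes e f :: "nat \<Rightarrow>\<^sub>0 nat"
  assumes "lookup e i > 0"
  shows "e - single i 1 = f \<longleftrightarrow> e = f + single i 1"
proof -
  have "e - single i 1 + single i 1 = e"
    using assms by (intro poly_mapping_eqI) (auto simp: lookup_add lookup_minus lookup_single when_def)
  then show ?thesis by auto
qed

text \<open>The truncated exponent \<open>e - single i 1\<close> is wrong only if X_i does not occur
  in the monomial, and then the coefficient is 0.\<close>

lemma partial_deriv_single: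
  "partial_deriv i (single e c)
    = single (e - single i 1) (of_nat (lookup e i) * c)"
proof (cases "lookup e i = 0")
  case True
  have "e \<noteq> e' + single i 1" for e'
    using True by (auto simp: lookup_add)
  then show ?thesis using True
    by (intro poly_mapping_eqI) (auto simp: partial_deriv.rep_eq lookup_single when_def)
next
  case False
  then have *: "e - single i 1 = f \<longleftrightarrow> e = f + single i 1" for f
    using exponent_diff_single_eq_iff by blast
  show ?thesis
  proof (rule poly_mapping_eqI)
    fix f
    show "lookup (partial_deriv i (single e c)) f = lookup
      (single (e - single i 1) (of_nat (lookup e i) * c)) f"
      unfolding partial_deriv.rep_eq lookup_single * when_def by (auto simp: lookup_add)
  qed
qed

lemma partial_deriv_add: "partial_deriv i (p + q) = partial_deriv i p + partial_deriv i q"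
  by (rule poly_mapping_eqI) (simp add: partial_deriv.rep_eq lookup_add algebra_simps)

text \<open>Both sides are additive in each factor, so two monomials suffice; there the rule is
  additivity of the exponent of X_i.\<close>

lemma partial_deriv_mult: "partial_deriv i (p * q) = partial_deriv i p * q + p * partial_deriv i q"
proof (induction p rule: poly_mapping_single_induct)
  case (1 e c)
  show ?case
  proof (induction q rule: poly_mapping_single_induct)
    case (1 f d)
    let ?s = "single i 1 :: nat \<Rightarrow>\<^sub>0 nat"
    have *: "e - ?s + f = e + f - ?s" if "lookup e i \<noteq> 0" for e f :: "nat \<Rightarrow>\<^sub>0 nat"
      using that by (intro poly_mapping_eqI) (auto simp: lookup_add lookup_minus lookup_single when_def)
    have 1: "partial_deriv i (single e c) * single f d
      = single (e + f - ?s) (of_nat (lookup e i) * c * d)"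
      using *[of e f] by (cases "lookup e i = 0") (auto simp: partial_deriv_single mult_single)
    have 2: "single e c * partial_deriv i (single f d)
      = single (e + f - ?s) (of_nat (lookup f i) * c * d)"
      using *[of f e] by (cases "lookup f i = 0") (auto simp: partial_deriv_single mult_single add_ac mult_ac)
    show ?case unfolding 1 2
      by (simp add: mult_single partial_deriv_single lookup_add algebra_simps flip: single_add)
  qed (simp add: partial_deriv_add algebra_simps)
qed (simp add: partial_deriv_add algebra_simps)

lemma partial_deriv_Con: "partial_deriv i (Con c) = 0"
  by (simp add: partial_deriv_single)

lemma partial_deriv_Var: "partial_deriv i (Var k) = (if i = k then 1 else 0)"
  by (auto simp: Var_def partial_deriv_single lookup_single when_def)

definition derivation :: "(mpoly \<Rightarrow> mpoly) \<Rightarrow> bool" where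
  "derivation d \<longleftrightarrow> (\<forall>p q. d (p + q) = d p + d q) \<and> (\<forall>p q. d (p * q) = d p * q + p * d q)
    \<and> (\<forall>c. d (Con c) = 0)"

lemma derivationD:
  assumes "derivation d"
  shows "d (p + q) = d p + d q" "d (p * q) = d p * q + p * d q" "d (Con c) = 0" "d 0 = 0" "d 1 = 0"
    "d (- p) = - d p" "d (p - q) = d p - d q" "d (sum f A) = (\<Sum>x\<in>A. d (f x))"
    "d (Con c * p) = Con c * d p" "d p = 0 \<Longrightarrow> d (p ^ n) = 0"
    "d (of_nat n) = 0" "d (numeral v) = 0"
proof -
  have add: "d (p + q) = d p + d q" and mult: "d (p * q) = d p * q + p * d q" and con: "d (Con c) = 0" for p q c
    using assms by (auto simp: derivation_def)
  show "d (p + q) = d p + d q" "d (p * q) = d p * q + p * d q" "d (Con c) = 0" by (fact add mult con)+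
  show zero: "d 0 = 0" using con[of 0] by simp
  show "d 1 = 0" using con[of 1] by simp
  show "d (Con c * p) = Con c * d p" by (simp add: mult con)
  show uminus: "d (- p) = - d p" for p using add[of p "-p"] zero by (simp add: eq_neg_iff_add_eq_0 add.commute)
  show "d (p - q) = d p - d q" using add[of p "-q"] uminus by simp
  show "d (sum f A) = (\<Sum>x\<in>A. d (f x))"
    by (induction A rule: infinite_finite_induct) (auto simp: zero add)
  show "d (of_nat n) = 0" using con[of "of_nat n"] by simp
  show "d (numeral v) = 0" using con[of "numeral v"] by simp
  show "d (p ^ n) = 0" if "d p = 0"
    using that con[of 1] by (induction n) (auto simp: mult)
qed

text \<open>A derivation is determined by its values on generators. This lets the commutation
  relation of the sl2 operators be checked on variables.\<close>

lemma derivation_eqI: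
  assumes "derivation d" "derivation d'" "\<And>i. d (Var i) = d' (Var i)"
  shows "d p = d' p"
proof -
  note d = derivationD(1-3)[OF assms(1)] derivationD(1-3)[OF assms(2)]
  show ?thesis
    by (induction p rule: mpoly_induct) (simp_all only: d assms(3))
qed

lemma derivation_partial_deriv: "derivation (partial_deriv i)"
  by (simp add: derivation_def partial_deriv_add partial_deriv_mult partial_deriv_Con)

lemma derivation_combination: "derivation (\<lambda>p. \<Sum>i\<in>A. g i * partial_deriv i p)"
  unfolding derivation_def
proof (intro conjI allI)
  fix p q :: mpoly and c :: real
  show "(\<Sum>i\<in>A. g i * partial_deriv i (p + q))
    = (\<Sum>i\<in>A. g i * partial_deriv i p) + (\<Sum>i\<in>A. g i * partial_deriv i q)"
    by (simp add: partial_deriv_add distrib_left sum.distrib)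
  have "g i * partial_deriv i (p * q) = (g i * partial_deriv i p) * q + p * (g i * partial_deriv i q)" for i
    by (simp add: partial_deriv_mult distrib_left mult_ac)
  then show "(\<Sum>i\<in>A. g i * partial_deriv i (p * q))
    = (\<Sum>i\<in>A. g i * partial_deriv i p) * q + p * (\<Sum>i\<in>A. g i * partial_deriv i q)"
    by (simp only: sum.distrib sum_distrib_left sum_distrib_right)
  show "(\<Sum>i\<in>A. g i * partial_deriv i (Con c)) = 0" by (simp add: partial_deriv_Con)
qed

text \<open>The mixed products \<open>d p * d' q\<close> and \<open>d' p * d q\<close> occur in both
  compositions and cancel.\<close>

lemma derivation_commutator:
  assumes "derivation d" "derivation d'"
  shows "derivation (\<lambda>p. d (d' p) - d' (d p))"
  by (simp add: derivation_def derivationD(1-4)[OF assms(1)] derivationD(1-4)[OF assms(2)])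
    (simp add: algebra_simps)

subsection \<open>The action of sl2\<close>

text \<open>
  The infinitesimal substitutions of the binary form with coefficients \<open>(j choose i) X_i\<close>. The
  junk values \<open>X_(0-1)\<close> and \<open>X_(j+1)\<close> carry the factor 0.
\<close>

definition lowering :: "nat \<Rightarrow> mpoly \<Rightarrow> mpoly" where
  "lowering j p = (\<Sum>i\<le>j. (of_nat i * Var (i - 1)) * partial_deriv i p)"

definition raising :: "nat \<Rightarrow> mpoly \<Rightarrow> mpoly" where
  "raising j p = (\<Sum>i\<le>j. (of_nat (j - i) * Var (i + 1)) * partial_deriv i p)"

definition weight_op :: "nat \<Rightarrow> mpoly \<Rightarrow> mpoly" where
  "weight_op j p = (\<Sum>i\<le>j. (Con (real j - 2 * real i) * Var i) * partial_deriv i p)"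

lemma derivation_lowering: "derivation (lowering j)"
  unfolding lowering_def[abs_def] by (rule derivation_combination)

lemma derivation_raising: "derivation (raising j)"
  unfolding raising_def[abs_def] by (rule derivation_combination)

lemma derivation_weight_op: "derivation (weight_op j)"
  unfolding weight_op_def[abs_def] by (rule derivation_combination)

lemma combination_Var:
  "(\<Sum>i\<le>j. g i * partial_deriv i (Var k)) = (if k \<le> j then g k else 0)"
proof -
  have "(\<Sum>i\<le>j. g i * partial_deriv i (Var k)) = (\<Sum>i\<le>j. if i = k then g i else 0)"
    by (rule sum.cong) (simp_all add: partial_deriv_Var)
  then show ?thesis by (simp add: sum.delta)
qed

lemma lowering_Var: "lowering j (Var k) = (if k \<le> j then of_nat k * Var (k - 1) else 0)"
  by (simp add: lowering_def combination_Var)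

lemma raising_Var: "raising j (Var k) = (if k \<le> j then of_nat (j - k) * Var (k + 1) else 0)"
  by (simp add: raising_def combination_Var)

lemma weight_op_Var: "weight_op j (Var k) = (if k \<le> j then Con (real j - 2 * real k) * Var k else 0)"
  by (simp add: weight_op_def combination_Var)

lemmas lowering_simps = derivationD[OF derivation_lowering]
lemmas raising_simps = derivationD[OF derivation_raising]

text \<open>Both sides are derivations, so only variables matter, and there the claim is (j - k)(k +
  1) - k(j - k + 1) = j - 2k.\<close>

lemma lowering_raising_commutator:
  "lowering j (raising j p) - raising j (lowering j p) = weight_op j p"
proof (rule derivation_eqI[OF derivation_commutator[OF derivation_lowering derivation_raising] derivation_weight_op])
  fix k
  show "lowering j (raising j (Var k)) - raising j (lowering j (Var k)) = weight_op j (Var k)"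
  proof (cases "k \<le> j")
    case True
    have L: "lowering j (raising j (Var k)) = of_nat ((j - k) * (k + 1)) * Var k"
    proof -
      have "lowering j (raising j (Var k)) = of_nat (j - k) * lowering j (Var (k + 1))"
        using True by (simp add: raising_Var lowering_simps)
      also have "\<dots> = of_nat ((j - k) * (k + 1)) * Var k"
        using True by (cases "k = j") (auto simp: lowering_Var mult.assoc simp del: of_nat_Suc of_nat_diff mult_Suc_right)
      finally show ?thesis .
    qed
    have R: "raising j (lowering j (Var k)) = of_nat (k * (j - k + 1)) * Var k"
    proof (cases k)
      case (Suc l)
      then have "raising j (lowering j (Var k)) = of_nat k * raising j (Var l)"
        using True by (simp add: lowering_Var raising_simps)
      also have "\<dots> = of_nat k * (of_nat (j - l) * Var k)"
        using True Suc by (simp add: raising_Var)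
      also have "j - l = j - k + 1" using True Suc by simp
      finally show ?thesis by (simp only: of_nat_mult mult.assoc)
    qed (use True in \<open>simp add: lowering_Var raising_simps\<close>)
    have *: "(of_nat n :: mpoly) = Con (real n)" for n by simp
    have "real ((j - k) * (k + 1)) - real (k * (j - k + 1)) = real j - 2 * real k"
      using le_Suc_ex[OF True] by (auto simp: algebra_simps)
    then have "(of_nat ((j - k) * (k + 1)) :: mpoly) - of_nat (k * (j - k + 1)) = Con (real j - 2 * real k)"
      unfolding * single_diff[symmetric] by simp
    then show ?thesis using True unfolding L R left_diff_distrib[symmetric] by (simp only: weight_op_Var if_True)
  next
    case False
    then show ?thesis by (simp add: raising_Var lowering_Var weight_op_Var lowering_simps raising_simps)
  qed
qed

text \<open>Here \<open>a\<close> is the degree and \<open>d\<close> the weight. They are integers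
  so that shifts such as \<open>a - n\<close> and \<open>d - w\<close> are never truncated; negative
  values give the empty set.\<close>

definition exps :: "nat \<Rightarrow> int \<Rightarrow> int \<Rightarrow> (nat \<Rightarrow>\<^sub>0 nat) set" where
  "exps j a d = {e. keys e \<subseteq> {..j} \<and> int (\<Sum>i\<le>j. lookup e i) = a
    \<and> int (\<Sum>i\<le>j. i * lookup e i) = d}"

definition homog :: "nat \<Rightarrow> int \<Rightarrow> int \<Rightarrow> mpoly set" where
  "homog j a d = {p. keys p \<subseteq> exps j a d}"

lemma exps_neg: "a < 0 \<or> d < 0 \<Longrightarrow> exps j a d = {}"
  by (auto simp: exps_def simp del: of_nat_sum)

lemma finite_exps: "finite (exps j a d)"
proof -
  define S where "S = {f :: nat \<Rightarrow> nat. \<forall>i. (i \<in> {..j} \<longrightarrow> f i \<in> {..nat a}) \<and> (i \<notin> {..j} \<longrightarrow> f i = 0)}"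
  have "exps j a d \<subseteq> lookup -` S"
  proof
    fix e assume "e \<in> exps j a d"
    then have e: "keys e \<subseteq> {..j}" "int (\<Sum>i\<le>j. lookup e i) = a"
      by (simp_all add: exps_def)
    have "lookup e i \<le> nat a" if "i \<le> j" for i
      unfolding e(2)[symmetric] nat_int using that by (intro member_le_sum) auto
    moreover have "lookup e i = 0" if "\<not> i \<le> j" for i
      using e(1) that by (meson atMost_iff in_keys_iff subsetD)
    ultimately show "e \<in> lookup -` S"
      by (simp add: S_def)
  qed
  moreover have "finite S"
    unfolding S_def by (rule finite_set_of_finite_funs) simp_all
  then have "finite (lookup -` S)"
    by (rule finite_vimageI) (simp add: inj_def lookup_inject)
  ultimately show ?thesis by (rule finite_subset)
qed

lemma exps_add:
  assumes "e \<in> exps j a d" "f \<in> exps j a' d'"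
  shows "e + f \<in> exps j (a + a') (d + d')"
  using assms keys_add[of e f]
  by (auto simp: exps_def lookup_add sum.distrib distrib_left)

lemma homog_zero [simp]: "0 \<in> homog j a d"
  by (simp add: homog_def)

lemma homog_add: "p \<in> homog j a d \<Longrightarrow> q \<in> homog j a d \<Longrightarrow> p + q \<in> homog j a d"
  using keys_add[of p q] by (auto simp: homog_def)

lemma homog_mult:
  assumes "p \<in> homog j a d" "q \<in> homog j a' d'"
  shows "p * q \<in> homog j (a + a') (d + d')"
  using assms keys_mult[of p q] exps_add unfolding homog_def by blast

lemma homog_Con: "Con c \<in> homog j 0 0"
  by (auto simp: homog_def exps_def)

lemma homog_scale: "p \<in> homog j a d \<Longrightarrow> Con c * p \<in> homog j a d"
  using homog_mult[OF homog_Con] by fastforce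

lemma homog_diff: "p \<in> homog j a d \<Longrightarrow> q \<in> homog j a d \<Longrightarrow> p - q \<in> homog j a d"
  using homog_add[of p j a d "Con (-1) * q"] homog_scale[of q j a d "-1"] by (simp add: single_uminus)

lemma homog_sum: "(\<And>x. x \<in> A \<Longrightarrow> f x \<in> homog j a d) \<Longrightarrow> sum f A \<in> homog j a d"
  by (induction A rule: infinite_finite_induct) (auto intro: homog_add)

lemma homog_of_nat_mult: "p \<in> homog j a d \<Longrightarrow> of_nat n * p \<in> homog j a d"
  using homog_scale[of p j a d "real n"] by simp

lemma homog_power: "p \<in> homog j a d \<Longrightarrow> p ^ n \<in> homog j (int n * a) (int n * d)"
proof (induction n)
  case 0
  then show ?case using homog_Con[of 1] by simp
next
  case (Suc n)
  from homog_mult[OF Suc.prems Suc.IH[OF Suc.prems]] show ?case by (simp add: algebra_simps)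
qed

lemma homog_Var: "i \<le> j \<Longrightarrow> Var i \<in> homog j 1 (int i)"
  by (auto simp: homog_def exps_def Var_def lookup_single when_def sum.delta if_distrib[of "(*) _"]
      simp del: of_nat_sum cong: if_cong)

text \<open>Since \<open>lowering\<close> decreases the weight, this makes it nilpotent on
  homogeneous polynomials.\<close>

lemma homog_neg: "p \<in> homog j a d \<Longrightarrow> d < 0 \<Longrightarrow> p = 0"
  using exps_neg[of a d j] by (auto simp: homog_def)

lemma homog_partial_deriv:
  assumes "p \<in> homog j a d" "i \<le> j"
  shows "partial_deriv i p \<in> homog j (a - 1) (d - int i)"
  unfolding homog_def
proof safe
  fix e assume "e \<in> keys (partial_deriv i p)"
  then have "e + single i 1 \<in> keys p"
    by (auto simp: in_keys_iff partial_deriv.rep_eq)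
  then have "e + single i 1 \<in> exps j a d"
    using assms by (auto simp: homog_def)
  then have e: "keys (e + single i 1) \<subseteq> {..j}"
    "int (\<Sum>k\<le>j. lookup (e + single i 1) k) = a"
    "int (\<Sum>k\<le>j. k * lookup (e + single i 1) k) = d"
    by (auto simp: exps_def)
  have "keys e \<subseteq> keys (e + single i 1)"
    by (auto simp: in_keys_iff lookup_add)
  moreover have "(\<Sum>k\<le>j. lookup (e + single i 1) k) = (\<Sum>k\<le>j. lookup e k) + 1"
    using assms(2) by (simp add: lookup_add sum.distrib lookup_single when_def sum.delta)
  moreover have "(\<Sum>k\<le>j. k * lookup (e + single i 1) k) = (\<Sum>k\<le>j. k * lookup e k) + i"
    using assms(2) by (simp add: lookup_add sum.distrib lookup_single when_def sum.delta
        distrib_left if_distrib[of "(*) _"] cong: if_cong)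
  ultimately show "e \<in> exps j (a - 1) (d - int i)"
    using e by (auto simp: exps_def simp del: of_nat_sum)
qed

lemma homog_lowering:
  assumes "p \<in> homog j a d"
  shows "lowering j p \<in> homog j a (d - 1)"
  unfolding lowering_def
proof (rule homog_sum)
  fix i assume i: "i \<in> {..j}"
  show "(of_nat i * Var (i - 1)) * partial_deriv i p \<in> homog j a (d - 1)"
  proof (cases i)
    case (Suc k)
    then have "Var k * partial_deriv i p \<in> homog j (1 + (a - 1)) (int k + (d - int i))"
      using i by (intro homog_mult homog_Var homog_partial_deriv assms) auto
    then have "of_nat i * (Var k * partial_deriv i p) \<in> homog j a (d - 1)"
      using Suc by (intro homog_of_nat_mult) simp
    then show ?thesis using Suc by (simp add: mult_ac)
  qed auto
qed

lemma homog_raising: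
  assumes "p \<in> homog j a d"
  shows "raising j p \<in> homog j a (d + 1)"
  unfolding raising_def
proof (rule homog_sum)
  fix i assume i: "i \<in> {..j}"
  show "(of_nat (j - i) * Var (i + 1)) * partial_deriv i p \<in> homog j a (d + 1)"
  proof (cases "i < j")
    case True
    then have "Var (i + 1) * partial_deriv i p \<in> homog j (1 + (a - 1)) (int (i + 1) + (d - int i))"
      by (intro homog_mult homog_Var homog_partial_deriv assms) auto
    then have "of_nat (j - i) * (Var (i + 1) * partial_deriv i p) \<in> homog j a (d + 1)"
      by (intro homog_of_nat_mult) (simp add: add.commute)
    then show ?thesis by (simp add: mult_ac)
  qed (use i in auto)
qed

text \<open>As in Euler's identity, X_i d/dX_i multiplies a monomial by its exponent of X_i. The
  resulting scalar is positive exactly below the middle weight.\<close>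

lemma weight_op_homog:
  assumes "p \<in> homog j a d"
  shows "weight_op j p = Con (real_of_int (int j * a - 2 * d)) * p"
proof -
  have single: "weight_op j (single e c) = Con (real_of_int (int j * a - 2 * d)) * single e c"
    if e: "e \<in> exps j a d" for e c
  proof -
    have V: "Var i * partial_deriv i (single e c) = single e (real (lookup e i) * c)" for i
    proof (cases "lookup e i = 0")
      case False
      then have "e - single i 1 + single i 1 = e"
        using exponent_diff_single_eq_iff[of e i "e - single i 1"] by simp
      then show ?thesis by (simp add: Var_def partial_deriv_single mult_single add.commute)
    qed (simp add: partial_deriv_single)
    have "weight_op j (single e c)
        = (\<Sum>i\<le>j. single e ((real j - 2 * real i) * (real (lookup e i) * c)))"
      unfolding weight_op_def mult.assoc V by (simp add: mult_single)
    also have "\<dots> = single e (\<Sum>i\<le>j. (real j - 2 * real i) * (real (lookup e i) * c))"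
      by (rule poly_mapping_eqI) (auto simp: lookup_sum lookup_single when_def)
    also have "(\<Sum>i\<le>j. (real j - 2 * real i) * (real (lookup e i) * c))
      = (real j * (\<Sum>i\<le>j. real (lookup e i)) - 2 * (\<Sum>i\<le>j. real (i * lookup e i))) * c"
      by (simp add: sum_distrib_left sum_distrib_right sum_subtractf algebra_simps)
    also have "(\<Sum>i\<le>j. real (lookup e i)) = real_of_int a"
      using e by (auto simp: exps_def)
    also have "(\<Sum>i\<le>j. real (i * lookup e i)) = real_of_int d"
      using e by (auto simp: exps_def)
    finally show ?thesis by (simp add: mult_single)
  qed
  note W = derivationD(8)[OF derivation_weight_op]
  have "weight_op j p = (\<Sum>e\<in>keys p. weight_op j (single e (lookup p e)))"
    using poly_mapping_sum_single[of p] W by metis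
  also have "\<dots> = (\<Sum>e\<in>keys p. Con (real_of_int (int j * a - 2 * d)) * single e (lookup p e))"
    using assms by (intro sum.cong refl single) (auto simp: homog_def)
  also have "\<dots> = Con (real_of_int (int j * a - 2 * d)) * p"
    unfolding sum_distrib_left[symmetric] using poly_mapping_sum_single[of p] by simp
  finally show ?thesis .
qed

subsection \<open>Unimodality of a quotient representation\<close>

definition sl2_invariant :: "nat \<Rightarrow> int \<Rightarrow> int \<Rightarrow> mpoly \<Rightarrow> bool" where
  "sl2_invariant j n w D \<longleftrightarrow> D \<in> homog j n w \<and> lowering j D = 0 \<and> raising j D = 0"

text \<open>
  If \<open>F x\<close> vanishes modulo \<open>D\<close> (where \<open>E\<close> lowers and \<open>F\<close> raises), then
  \<open>F (E^(i+1) x)\<close> is modulo \<open>D\<close> a negative multiple of \<open>E^i x\<close>, because the weights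
  involved are positive. As \<open>E\<close> is nilpotent, \<open>x\<close> itself vanishes modulo \<open>D\<close>.
\<close>

lemma raising_injective_modulo_invariant:
  assumes D: "sl2_invariant j n w D"
    and x: "x \<in> homog j a d" and Fx: "raising j x \<in> (*) D ` homog j (a - n) (d + 1 - w)"
    and d: "2 * d < int j * a"
  shows "x \<in> (*) D ` homog j (a - n) (d - w)"
proof -
  \<comment> \<open>\<open>B d\<close> consists of the multiples of \<open>D\<close> in degree
    \<open>a\<close> and weight \<open>d\<close>; because \<open>D\<close> is invariant, both
    operators respect this family.\<close>
  define B where "B d = (*) D ` homog j (a - n) (d - w)" for d
  have B_add: "p + q \<in> B d" if "p \<in> B d" "q \<in> B d" for p q d
    using that homog_add unfolding B_def by (auto simp: image_iff simp flip: distrib_left)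
  have B_scale: "Con c * p \<in> B d" if "p \<in> B d" for p c d
    using that homog_scale unfolding B_def by (auto simp: image_iff mult.left_commute)
  have B_diff: "p - q \<in> B d" if "p \<in> B d" "q \<in> B d" for p q d
    using that homog_diff unfolding B_def by (auto simp: image_iff simp flip: right_diff_distrib)
  have B_low: "lowering j p \<in> B (d - 1)" if p: "p \<in> B d" for p d
  proof -
    obtain q where q: "p = D * q" "q \<in> homog j (a - n) (d - w)" using p by (auto simp: B_def)
    have "lowering j p = D * lowering j q" using D by (simp add: q sl2_invariant_def lowering_simps(2))
    then show ?thesis using homog_lowering[OF q(2)] by (auto simp: B_def algebra_simps)
  qed
  have B_raise: "raising j p \<in> B (d + 1)" if p: "p \<in> B d" for p d
  proof -
    obtain q where q: "p = D * q" "q \<in> homog j (a - n) (d - w)" using p by (auto simp: B_def)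
    have "raising j p = D * raising j q" using D by (simp add: q sl2_invariant_def raising_simps(2))
    then show ?thesis using homog_raising[OF q(2)] by (auto simp: B_def algebra_simps)
  qed
  define y where "y i = (lowering j ^^ i) x" for i
  have y_homog: "y i \<in> homog j a (d - int i)" for i
  proof (induction i)
    case (Suc i)
    from homog_lowering[OF Suc] show ?case by (simp add: y_def algebra_simps)
  qed (use x in \<open>simp add: y_def\<close>)
  have y_Suc: "y (Suc i) = lowering j (y i)" for i by (simp add: y_def)
  have comm: "raising j (y (Suc i)) + Con (real_of_int (int j * a - 2 * (d - int i))) * y i
    = lowering j (raising j (y i))" for i
    unfolding y_Suc weight_op_homog[OF y_homog, symmetric] lowering_raising_commutator[symmetric] by simp
  \<comment> \<open>\<open>s\<close> is the sum of the eigenvalues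
    \<open>int j * a - 2 * (d - int l)\<close> of \<open>weight_op\<close> for l from 0 to
    \<open>i\<close>, all positive by the hypothesis on \<open>d\<close>.\<close>
  have step: "\<exists>s>0. raising j (y (Suc i)) + Con s * y i \<in> B (d - int i)" for i
  proof (induction i)
    case 0
    have "lowering j (raising j x) \<in> B d"
      using B_low[of "raising j x" "d + 1"] Fx by (simp add: B_def)
    then have "raising j (y (Suc 0)) + Con (real_of_int (int j * a - 2 * (d - int 0))) * y 0 \<in> B (d - int 0)"
      unfolding comm by (simp add: y_def)
    moreover have "real_of_int (int j * a - 2 * (d - int 0)) > 0" using d unfolding of_int_0_less_iff by simp
    ultimately show ?case by blast
  next
    case (Suc i)
    then obtain s where s: "s > 0" "raising j (y (Suc i)) + Con s * y i \<in> B (d - int i)" by blast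
    define h where "h = real_of_int (int j * a - 2 * (d - int (Suc i)))"
    have h: "h > 0" using d unfolding h_def of_int_0_less_iff by simp
    have "lowering j (raising j (y (Suc i)) + Con s * y i) \<in> B (d - int i - 1)"
      by (rule B_low[OF s(2)])
    also have "lowering j (raising j (y (Suc i)) + Con s * y i)
      = raising j (y (Suc (Suc i))) + Con h * y (Suc i) + Con s * y (Suc i)"
      unfolding lowering_simps(1,9) comm[symmetric] y_Suc[symmetric] h_def ..
    also have "\<dots> = raising j (y (Suc (Suc i))) + Con (h + s) * y (Suc i)"
      by (simp add: single_add distrib_right)
    finally have "raising j (y (Suc (Suc i))) + Con (h + s) * y (Suc i) \<in> B (d - int (Suc i))"
      by (simp add: algebra_simps)
    moreover have "h + s > 0" using h s(1) by simp
    ultimately show ?case by blast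
  qed
  have down: "y i \<in> B (d - int i) \<Longrightarrow> y 0 \<in> B d" for i
  proof (induction i)
    case (Suc i)
    obtain s where s: "s > 0" "raising j (y (Suc i)) + Con s * y i \<in> B (d - int i)" using step by blast
    have "raising j (y (Suc i)) \<in> B (d - int i)" using B_raise[OF Suc.prems] by simp
    from B_diff[OF s(2) this] have "Con s * y i \<in> B (d - int i)" by simp
    from B_scale[OF this, of "1 / s"] s(1) have "y i \<in> B (d - int i)"
      by (simp add: mult_single flip: mult.assoc)
    then show ?case by (rule Suc.IH)
  qed simp
  \<comment> \<open>The weight \<open>d - int (nat (d + 1))\<close> is negative, also when
    \<open>d\<close> itself is.\<close>
  have "y (nat (d + 1)) = 0"
    using y_homog[of "nat (d + 1)"] by (rule homog_neg) linarith
  moreover have "0 \<in> B d" for d using B_def by force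
  ultimately show ?thesis using down[of "nat (d + 1)"] by (simp add: y_def B_def)
qed

text \<open>Modulo multiples of \<open>D\<close>, \<open>raising\<close> is injective from weight
  \<open>d\<close> to weight \<open>d + 1\<close> below the middle. Monomials count the dimensions,
  and multiples of \<open>D\<close> are counted by their cofactors, of degree
  \<open>a - n\<close>.\<close>

lemma card_exps_diff_mono:
  assumes D: "sl2_invariant j n w D" "D \<noteq> 0"
    and d: "2 * d < int j * a"
  shows "card (exps j a d) + card (exps j (a - n) (d + 1 - w))
    \<le> card (exps j a (d + 1)) + card (exps j (a - n) (d - w))"
proof -
  interpret vs: vector_space "\<lambda>c p. Con c * p"
    by unfold_locales (simp_all add: distrib_left distrib_right single_add mult_single flip: mult.assoc)
  define M where "M a d = (\<lambda>e. single e 1 :: mpoly) ` exps j a d" for a d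
  have inj: "inj_on (\<lambda>e. single e 1 :: mpoly) A" for A
    by (rule inj_onI) (metis keys_single singleton_inject zero_neq_one)
  have fin: "finite (M a d)" and card: "card (M a d) = card (exps j a d)" for a d
    unfolding M_def by (simp_all add: finite_exps card_image[OF inj])
  have span: "vs.span (M a d) = homog j a d" for a d
  proof
    have "vs.subspace (homog j a d)"
      by (auto simp: vs.subspace_def homog_add homog_scale)
    moreover have "M a d \<subseteq> homog j a d" by (auto simp: M_def homog_def)
    ultimately show "vs.span (M a d) \<subseteq> homog j a d" by (rule vs.span_minimal[rotated])
    show "homog j a d \<subseteq> vs.span (M a d)"
    proof
      fix p assume p: "p \<in> homog j a d"
      have "(\<Sum>e\<in>keys p. Con (lookup p e) * single e 1) \<in> vs.span (M a d)"
        using p by (intro vs.span_sum vs.span_scale vs.span_base) (auto simp: M_def homog_def)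
      then show "p \<in> vs.span (M a d)"
        using poly_mapping_sum_single[of p] by (simp add: mult_single)
    qed
  qed
  have ind: "vs.independent (M a d)" for a d
  proof (rule vs.independent_if_scalars_zero[OF fin])
    fix f x assume 0: "(\<Sum>x\<in>M a d. Con (f x) * x) = 0" and "x \<in> M a d"
    then obtain e where e: "x = single e 1" "e \<in> exps j a d" by (auto simp: M_def)
    have "(\<Sum>x\<in>M a d. Con (f x) * x) = (\<Sum>e\<in>exps j a d. single e (f (single e 1)))"
      unfolding M_def by (subst sum.reindex[OF inj]) (simp add: mult_single)
    then have "lookup (\<Sum>e\<in>exps j a d. single e (f (single e 1))) e = 0"
      using 0 by simp
    then show "f x = 0"
      using e finite_exps by (simp add: lookup_sum lookup_single when_def sum.delta cong: if_cong)
  qed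
  \<comment> \<open>The polynomial ring is an integral domain.\<close>
  have injD: "inj_on ((*) D) A" for A using D(2) by (auto intro: inj_onI)
  have lin: "Vector_Spaces.linear (\<lambda>c p. Con c * p) (\<lambda>c p. Con c * p) ((*) D)"
    by unfold_locales (simp_all add: algebra_simps)
  interpret D: Vector_Spaces.linear "\<lambda>c p. Con c * p" "\<lambda>c p. Con c * p" "(*) D" by (rule lin)
  have indD: "vs.independent ((*) D ` M a d)" for a d
    by (rule D.independent_injective_image[OF ind injD])
  have spanD: "vs.span ((*) D ` M a d) = (*) D ` homog j a d" for a d
    by (simp add: D.span_image span)
  have cardD: "card ((*) D ` M a d) = card (exps j a d)" for a d
    by (simp add: card_image[OF injD] card)
  have D_homog: "(*) D ` M (a - n) (d - w) \<subseteq> vs.span (M a d)" for a d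
  proof
    fix x assume "x \<in> (*) D ` M (a - n) (d - w)"
    then obtain p where p: "x = D * p" "p \<in> homog j (a - n) (d - w)"
      using vs.span_superset span by blast
    then show "x \<in> vs.span (M a d)"
      using homog_mult[of D j n w p "a - n" "d - w"] D(1) by (simp add: span sl2_invariant_def)
  qed
  have "card (M a d) + card ((*) D ` M (a - n) (d + 1 - w)) \<le> card (M a (d + 1)) + card ((*) D ` M (a - n) (d - w))"
  proof (rule vs.card_quotient_le[where f = "raising j"])
    fix x assume "x \<in> vs.span (M a d)" "raising j x \<in> vs.span ((*) D ` M (a - n) (d + 1 - w))"
    then show "x \<in> vs.span ((*) D ` M (a - n) (d - w))"
      unfolding span spanD by (rule raising_injective_modulo_invariant[OF D(1) _ _ d])
  qed (rule fin ind indD D_homog raising_simps(1,9) | simp only: span homog_raising)+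
  then show ?thesis by (simp add: card cardD)
qed

subsection \<open>Invariants of binary forms\<close>

text \<open>
  For \<open>n = j\<close> this is the \<open>j\<close>-th transvectant of the form with itself; for \<open>n = j - 1\<close> and
  \<open>s, t \<le> 1\<close> these are the coefficients of the quadratic covariant, its \<open>(j-1)\<close>-st transvectant
  with itself.
\<close>

definition transvectant :: "nat \<Rightarrow> nat \<Rightarrow> nat \<Rightarrow> mpoly" where
  "transvectant n s t = (\<Sum>i\<le>n. Con ((-1) ^ i * real (n choose i)) * (Var (i + s) * Var (n - i + t)))"

text \<open>Absorption turns the coefficients into n (n-1 choose i-1) and n (n-1 choose i); after an
  index shift the two sums cancel by sign. The junk value \<open>g (i - 1)\<close> at
  \<open>i = 0\<close> has factor 0.\<close>

lemma alternating_binomial_absorption: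
  fixes g :: "nat \<Rightarrow> mpoly"
  shows "(\<Sum>i\<le>n. Con ((-1) ^ i * real (n choose i)) * (of_nat i * g (i - 1) + of_nat (n - i) * g i)) = 0"
proof (cases n)
  case (Suc m)
  have of_nat_Con: "(of_nat r :: mpoly) = Con (real r)" for r by simp
  have merge: "Con c * (of_nat r * p) = Con (c * real r) * p" for c r and p :: mpoly
    unfolding of_nat_Con mult.assoc[symmetric] mult_single by simp
  have 1: "(\<Sum>i\<le>n. Con ((-1) ^ i * real (n choose i)) * (of_nat i * g (i - 1)))
    = (\<Sum>i\<le>m. Con (- ((-1) ^ i * real (n * (m choose i)))) * g i)"
  proof -
    have "(\<Sum>i\<le>n. Con ((-1) ^ i * real (n choose i)) * (of_nat i * g (i - 1)))
      = (\<Sum>i\<le>m. Con ((-1) ^ Suc i * real (n choose Suc i)) * (of_nat (Suc i) * g i))"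
      unfolding Suc by (subst sum.atMost_Suc_shift) simp
    also have "\<dots> = (\<Sum>i\<le>m. Con (- ((-1) ^ i * real (n * (m choose i)))) * g i)"
    proof (rule sum.cong[OF refl])
      fix i
      have "real (n choose Suc i) * real (Suc i) = real (n * (m choose i))"
        using Suc_times_binomial[of i m] unfolding Suc by (metis mult.commute of_nat_mult)
      then show "Con ((-1) ^ Suc i * real (n choose Suc i)) * (of_nat (Suc i) * g i)
        = Con (- ((-1) ^ i * real (n * (m choose i)))) * g i"
        unfolding merge by (simp add: mult.assoc)
    qed
    finally show ?thesis .
  qed
  have 2: "(\<Sum>i\<le>n. Con ((-1) ^ i * real (n choose i)) * (of_nat (n - i) * g i))
    = (\<Sum>i\<le>m. Con ((-1) ^ i * real (n * (m choose i))) * g i)"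
  proof -
    have "(\<Sum>i\<le>n. Con ((-1) ^ i * real (n choose i)) * (of_nat (n - i) * g i))
      = (\<Sum>i\<le>m. Con ((-1) ^ i * real (n choose i)) * (of_nat (n - i) * g i))"
      unfolding Suc by (subst sum.atMost_Suc) simp
    also have "\<dots> = (\<Sum>i\<le>m. Con ((-1) ^ i * real (n * (m choose i))) * g i)"
    proof (rule sum.cong[OF refl])
      fix i
      have "real (n choose i) * real (n - i) = real (n * (m choose i))"
        using binomial_absorb_comp[of n i] unfolding Suc by (metis diff_Suc_1 mult.commute of_nat_mult)
      then show "Con ((-1) ^ i * real (n choose i)) * (of_nat (n - i) * g i)
        = Con ((-1) ^ i * real (n * (m choose i))) * g i"
        unfolding merge by (simp add: mult.assoc)
    qed
    finally show ?thesis .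
  qed
  show ?thesis
    unfolding distrib_left sum.distrib 1 2 single_uminus by (simp add: sum_negf)
qed simp

text \<open>The factor \<open>i + s\<close> arising from \<open>Var (i + s)\<close> splits into
  \<open>i\<close> and \<open>s\<close>, and likewise for the other variable. The parts
  \<open>i\<close> and \<open>n - i\<close> cancel by
  \<open>alternating_binomial_absorption\<close>; those from \<open>s\<close> and \<open>t\<close>
  remain.\<close>

lemma lowering_transvectant:
  assumes "n + s \<le> j" "n + t \<le> j"
  shows "lowering j (transvectant n s t)
    = of_nat s * transvectant n (s - 1) t + of_nat t * transvectant n s (t - 1)"
proof -
  \<comment> \<open>For \<open>i \<le> n\<close> the subtraction of 1 truncates only when
    \<open>i = n\<close> and \<open>t = 0\<close>, where \<open>g i\<close> is multiplied by
    \<open>of_nat (n - i)\<close>, which is 0.\<close>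
  define g where "g i = Var (i + s) * Var (n - i + t - 1)" for i
  have term_eq: "lowering j (Con c * (Var (i + s) * Var (n - i + t)))
      = Con c * (of_nat i * g (i - 1) + of_nat (n - i) * g i)
        + (of_nat s * (Con c * (Var (i + (s - 1)) * Var (n - i + t)))
        + of_nat t * (Con c * (Var (i + s) * Var (n - i + (t - 1)))))" if "i \<le> n" for i c
  proof -
    have v1: "lowering j (Var (i + s)) = of_nat i * Var (i - 1 + s) + of_nat s * Var (i + (s - 1))"
    proof -
      have "of_nat i * Var (i + s - 1) = of_nat i * Var (i - 1 + s)" by (cases i) auto
      moreover have "of_nat s * Var (i + s - 1) = of_nat s * Var (i + (s - 1))" by (cases s) auto
      moreover have "lowering j (Var (i + s)) = of_nat (i + s) * Var (i + s - 1)"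
        using that assms by (simp add: lowering_Var)
      ultimately show ?thesis by (simp only: of_nat_add distrib_right)
    qed
    have v2: "lowering j (Var (n - i + t)) = of_nat (n - i) * Var (n - i + t - 1) + of_nat t * Var (n - i + (t - 1))"
    proof -
      have "of_nat t * Var (n - i + t - 1) = of_nat t * Var (n - i + (t - 1))" by (cases t) auto
      moreover have "n - i + t \<le> j" using assms by simp
      then have "lowering j (Var (n - i + t)) = of_nat (n - i + t) * Var (n - i + t - 1)"
        by (simp only: lowering_Var if_True)
      ultimately show ?thesis by (simp only: of_nat_add distrib_right)
    qed
    have g: "of_nat i * g (i - 1) = of_nat i * (Var (i - 1 + s) * Var (n - i + t))"
    proof (cases i)
      case (Suc l)
      then have "n - l + t - 1 = n - i + t" using that by simp
      then show ?thesis using Suc by (simp add: g_def)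
    qed simp
    show ?thesis
      unfolding lowering_simps(2,3) v1 v2 g unfolding g_def
      by (simp only: distrib_left distrib_right mult_zero_left add_0_left ac_simps)
  qed
  have "lowering j (transvectant n s t)
    = (\<Sum>i\<le>n. lowering j (Con ((-1) ^ i * real (n choose i)) * (Var (i + s) * Var (n - i + t))))"
    unfolding transvectant_def lowering_simps(8) ..
  also have "\<dots>
    = (\<Sum>i\<le>n. Con ((-1) ^ i * real (n choose i)) * (of_nat i * g (i - 1) + of_nat (n - i) * g i)
        + (of_nat s * (Con ((-1) ^ i * real (n choose i)) * (Var (i + (s - 1)) * Var (n - i + t)))
        + of_nat t * (Con ((-1) ^ i * real (n choose i)) * (Var (i + s) * Var (n - i + (t - 1))))))"
    by (rule sum.cong[OF refl], rule term_eq) simp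
  also have "\<dots> = of_nat s * transvectant n (s - 1) t + of_nat t * transvectant n s (t - 1)"
    unfolding sum.distrib alternating_binomial_absorption transvectant_def sum_distrib_left by simp
  finally show ?thesis .
qed

text \<open>Now \<open>j - (i + s)\<close> splits as \<open>(n - i) + (j - n - s)\<close>, so
  \<open>i\<close> and \<open>n - i\<close> exchange roles in the same cancellation.\<close>

lemma raising_transvectant:
  assumes "n + s \<le> j" "n + t \<le> j"
  shows "raising j (transvectant n s t)
    = of_nat (j - n - s) * transvectant n (s + 1) t + of_nat (j - n - t) * transvectant n s (t + 1)"
proof -
  define g where "g i = Var (i + s + 1) * Var (n - i + t)" for i
  have term_eq: "raising j (Con c * (Var (i + s) * Var (n - i + t)))
      = Con c * (of_nat i * g (i - 1) + of_nat (n - i) * g i)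
        + (of_nat (j - n - s) * (Con c * (Var (i + (s + 1)) * Var (n - i + t)))
        + of_nat (j - n - t) * (Con c * (Var (i + s) * Var (n - i + (t + 1)))))" if "i \<le> n" for i c
  proof -
    have v1: "raising j (Var (i + s)) = of_nat (n - i) * Var (i + s + 1) + of_nat (j - n - s) * Var (i + s + 1)"
    proof -
      have "raising j (Var (i + s)) = of_nat (j - (i + s)) * Var (i + s + 1)"
        using that assms by (simp add: raising_Var)
      also have "j - (i + s) = (n - i) + (j - n - s)" using that assms by simp
      finally show ?thesis by (simp only: of_nat_add distrib_right)
    qed
    have v2: "raising j (Var (n - i + t)) = of_nat i * Var (n - i + t + 1) + of_nat (j - n - t) * Var (n - i + t + 1)"
    proof -
      have "n - i + t \<le> j" using assms by simp
      then have "raising j (Var (n - i + t)) = of_nat (j - (n - i + t)) * Var (n - i + t + 1)"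
        by (simp only: raising_Var if_True)
      also have "j - (n - i + t) = i + (j - n - t)" using that assms by simp
      finally show ?thesis by (simp only: of_nat_add distrib_right)
    qed
    have g: "of_nat i * g (i - 1) = of_nat i * (Var (i + s) * Var (n - i + t + 1))"
    proof (cases i)
      case (Suc l)
      then have "n - l + t = n - i + t + 1" using that by simp
      then show ?thesis using Suc by (simp add: g_def)
    qed simp
    show ?thesis
      unfolding raising_simps(2,3) v1 v2 g unfolding g_def
      by (simp only: distrib_left distrib_right mult_zero_left add_0_left ac_simps)
  qed
  have "raising j (transvectant n s t)
    = (\<Sum>i\<le>n. raising j (Con ((-1) ^ i * real (n choose i)) * (Var (i + s) * Var (n - i + t))))"
    unfolding transvectant_def raising_simps(8) ..
  also have "\<dots>
    = (\<Sum>i\<le>n. Con ((-1) ^ i * real (n choose i)) * (of_nat i * g (i - 1) + of_nat (n - i) * g i)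
        + (of_nat (j - n - s) * (Con ((-1) ^ i * real (n choose i)) * (Var (i + (s + 1)) * Var (n - i + t)))
        + of_nat (j - n - t) * (Con ((-1) ^ i * real (n choose i)) * (Var (i + s) * Var (n - i + (t + 1))))))"
    by (rule sum.cong[OF refl], rule term_eq) simp
  also have "\<dots> = of_nat (j - n - s) * transvectant n (s + 1) t + of_nat (j - n - t) * transvectant n s (t + 1)"
    unfolding sum.distrib alternating_binomial_absorption transvectant_def sum_distrib_left by simp
  finally show ?thesis .
qed

lemma homog_transvectant:
  assumes "n + s \<le> j" "n + t \<le> j"
  shows "transvectant n s t \<in> homog j 2 (int (n + s + t))"
  unfolding transvectant_def
proof (intro homog_sum homog_scale)
  fix i assume "i \<in> {..n}"
  then show "Var (i + s) * Var (n - i + t) \<in> homog j 2 (int (n + s + t))"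
    using homog_mult[OF homog_Var[of "i + s" j] homog_Var[of "n - i + t" j]] assms
    by (simp add: of_nat_diff algebra_simps)
qed

text \<open>Replacing \<open>i\<close> by \<open>n - i\<close> costs the sign (-1)^n. For odd
  \<open>n\<close> that sign forces the transvectants with \<open>s = t\<close> to vanish, which is
  why odd \<open>j\<close> calls for a quartic invariant.\<close>

lemma transvectant_commute:
  assumes "even n"
  shows "transvectant n s t = transvectant n t s"
proof -
  have "transvectant n s t
    = (\<Sum>i\<le>n. Con ((-1) ^ (n - i) * real (n choose (n - i))) * (Var (n - i + s) * Var (n - (n - i) + t)))"
    unfolding transvectant_def by (rule sum.reindex_bij_witness[of _ "\<lambda>i. n - i" "\<lambda>i. n - i"]) auto
  also have "\<dots> = transvectant n t s"
    unfolding transvectant_def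
  proof (rule sum.cong[OF refl])
    fix i assume "i \<in> {..n}"
    then have i: "i \<le> n" by simp
    then have "(-1 :: real) ^ (n - i) = (-1) ^ i"
      using assms by (simp add: minus_one_power_iff)
    then show "Con ((-1) ^ (n - i) * real (n choose (n - i))) * (Var (n - i + s) * Var (n - (n - i) + t))
      = Con ((-1) ^ i * real (n choose i)) * (Var (i + t) * Var (n - i + s))"
      using i by (simp add: binomial_symmetric[OF i] mult.commute)
  qed
  finally show ?thesis .
qed

text \<open>A test for nonvanishing. X_0 occurs only in the term \<open>i = 0\<close> when
  \<open>s = 0\<close> and in the term \<open>i = n\<close> when \<open>t = 0\<close>, the latter
  with sign +1 as \<open>n\<close> is even.\<close>

lemma partial_deriv_transvectant:
  assumes "even n"
  shows "partial_deriv 0 (transvectant n s t)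
    = (if s = 0 then Var (n + t) else 0) + (if t = 0 then Var (n + s) else 0)"
proof -
  have "partial_deriv 0 (transvectant n s t)
    = (\<Sum>i\<le>n. if i = 0 then (if s = 0 then Var (n + t) else 0) else 0)
      + (\<Sum>i\<le>n. if i = n then (if t = 0 then Var (n + s) else 0) else 0)"
    unfolding transvectant_def derivationD(8,9)[OF derivation_partial_deriv] sum.distrib[symmetric]
    by (rule sum.cong) (use assms in \<open>auto simp: partial_deriv_mult partial_deriv_Var\<close>)
  then show ?thesis by (simp add: sum.delta)
qed

section \<open>Explicit invariants of degrees 2 and 4 and their powers\<close>

lemma Var_nonzero: "Var i \<noteq> 0"
  by (simp add: Var_def flip: keys_eq_empty)

lemma sl2_invariant_power:
  assumes "sl2_invariant j n w D"
  shows "sl2_invariant j (int r * n) (int r * w) (D ^ r)"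
  using assms by (auto simp: sl2_invariant_def intro: homog_power lowering_simps(10) raising_simps(10))

text \<open>For \<open>n = j\<close> and \<open>s = t = 0\<close> all factors in the formulas for
  the two operators are 0.\<close>

lemma quadratic_invariant:
  assumes "even j" "j > 0"
  shows "sl2_invariant j 2 (int j) (transvectant j 0 0)" "transvectant j 0 0 \<noteq> 0"
proof -
  show "sl2_invariant j 2 (int j) (transvectant j 0 0)"
    using homog_transvectant[of j 0 j 0] lowering_transvectant[of j 0 j 0] raising_transvectant[of j 0 j 0]
    by (simp add: sl2_invariant_def)
  have "partial_deriv 0 (transvectant j 0 0) = 2 * Var j"
    using assms by (simp add: partial_deriv_transvectant)
  then show "transvectant j 0 0 \<noteq> 0"
    using Var_nonzero[of j] derivationD(4)[OF derivation_partial_deriv, of 0] by auto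
qed

text \<open>\<open>A\<close>, \<open>B\<close>, \<open>C\<close> transform like the coefficients of
  a quadratic form A x^2 + 2B xy + C y^2, and \<open>D\<close> is its discriminant up to a constant.
  It is nonzero because its second X_0-derivative is 2 X_j^2.\<close>

lemma quartic_invariant:
  assumes "odd j" "j > 1"
  defines "D \<equiv> (transvectant (j - 1) 0 1)\<^sup>2 - transvectant (j - 1) 0 0 * transvectant (j - 1) 1 1"
  shows "sl2_invariant j 4 (2 * int j) D" "D \<noteq> 0"
proof -
  define n where "n = j - 1"
  have n: "even n" "n > 0" "j = Suc n" using assms by (auto simp: n_def)
  define A B C where "A = transvectant n 0 0" and "B = transvectant n 0 1" and "C = transvectant n 1 1"
  have D: "D = B * B - A * C" by (simp add: D_def A_def B_def C_def n_def power2_eq_square)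
  have B': "transvectant n 1 0 = B" unfolding B_def by (rule transvectant_commute[OF n(1)])
  have homog: "A \<in> homog j 2 (int n)" "B \<in> homog j 2 (int (n + 1))" "C \<in> homog j 2 (int (n + 2))"
    using homog_transvectant[of n 0 j 0] homog_transvectant[of n 0 j 1] homog_transvectant[of n 1 j 1] n(3)
    by (simp_all add: A_def B_def C_def)
  have low: "lowering j A = 0" "lowering j B = A" "lowering j C = 2 * B"
    using lowering_transvectant[of n 0 j 0] lowering_transvectant[of n 0 j 1] lowering_transvectant[of n 1 j 1] n B'
    by (simp_all add: A_def B_def C_def)
  have up: "raising j C = 0" "raising j B = C" "raising j A = 2 * B"
    using raising_transvectant[of n 0 j 0] raising_transvectant[of n 0 j 1] raising_transvectant[of n 1 j 1] n B'
    by (simp_all add: A_def B_def C_def)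
  have "lowering j D = 0" "raising j D = 0"
    unfolding D lowering_simps(2,7) low raising_simps(2,7) up by (simp_all add: algebra_simps)
  moreover have "D \<in> homog j 4 (2 * int j)"
    unfolding D using homog_mult[OF homog(2,2)] homog_mult[OF homog(1,3)] n(3)
    by (intro homog_diff) (simp_all add: algebra_simps)
  ultimately show "sl2_invariant j 4 (2 * int j) D" by (simp add: sl2_invariant_def)
  have "partial_deriv 0 A = 2 * Var n" "partial_deriv 0 B = Var j" "partial_deriv 0 C = 0"
    using n by (simp_all add: A_def B_def C_def partial_deriv_transvectant)
  moreover have "partial_deriv 0 (Var n)
    = 0" "partial_deriv 0 (Var j) = 0" using n by (simp_all add: partial_deriv_Var)
  ultimately have "partial_deriv 0 (partial_deriv 0 D) = 2 * (Var j * Var j)"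
    unfolding D derivationD(2,7)[OF derivation_partial_deriv]
    by (simp add: derivationD[OF derivation_partial_deriv])
  then show "D \<noteq> 0"
    using Var_nonzero[of j] derivationD(4)[OF derivation_partial_deriv, of 0] by auto
qed

text \<open>The degree matches the shift of \<open>b\<close> in the theorem, the weight the
  resulting shift of the exponent of q.\<close>

lemma invariant_of_discriminant_degree_exists:
  assumes "j \<ge> 2"
  shows "\<exists>D. D \<noteq> 0 \<and> sl2_invariant j (2 * (int j - 1)) (int j * (int j - 1)) D"
proof (cases "even j")
  case True
  then have "sl2_invariant j (int (j - 1) * 2) (int (j - 1) * int j) (transvectant j 0 0 ^ (j - 1))"
    "transvectant j 0 0 ^ (j - 1) \<noteq> 0"
    using assms by (intro sl2_invariant_power power_not_zero quadratic_invariant; simp)+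
  moreover have "int (j - 1) * 2 = 2 * (int j - 1)" "int (j - 1) * int j = int j * (int j - 1)"
    using assms by (simp_all add: of_nat_diff)
  ultimately show ?thesis by metis
next
  case False
  then obtain r where r: "j = 2 * r + 1" by (elim oddE)
  obtain D where "sl2_invariant j 4 (2 * int j) D" "D \<noteq> 0"
    using quartic_invariant[of j] False assms by auto
  then have "sl2_invariant j (int r * 4) (int r * (2 * int j)) (D ^ r)" "D ^ r \<noteq> 0"
    by (auto intro: sl2_invariant_power)
  moreover have "int r * 4 = 2 * (int j - 1)" "int r * (2 * int j) = int j * (int j - 1)"
    using r by simp_all
  ultimately show ?thesis by metis
qed

subsection \<open>Counting monomials by q-binomial coefficients\<close>

text \<open>A monomial either avoids the last variable or can be divided by it once; this is the
  recursion of the q-Pascal rule.\<close>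

lemma card_exps_Suc:
  "card (exps (Suc j) a d) = card (exps j a d) + card (exps (Suc j) (a - 1) (d - int (Suc j)))"
proof -
  define s :: "nat \<Rightarrow>\<^sub>0 nat" where "s = single (Suc j) 1"
  have lookup_s: "lookup s i = (if i = Suc j then 1 else 0)" for i
    by (simp add: s_def lookup_single when_def)
  have 1: "{e \<in> exps (Suc j) a d. lookup e (Suc j) = 0} = exps j a d"
  proof -
    have *: "keys e \<subseteq> {..Suc j} \<and> lookup e (Suc j)
      = 0 \<longleftrightarrow> keys e \<subseteq> {..j}" for e :: "nat \<Rightarrow>\<^sub>0 nat"
      unfolding subset_iff in_keys_iff atMost_iff by (metis le_Suc_eq Suc_n_not_le_n)
    show ?thesis
    proof (rule set_eqI)
      fix e
      show "e \<in> {e \<in> exps (Suc j) a d. lookup e (Suc j) = 0} \<longleftrightarrow> e \<in> exps j a d"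
        using *[of e] by (cases "lookup e (Suc j) = 0") (simp_all add: exps_def)
    qed
  qed
  have shift: "e + s \<in> exps (Suc j) a d \<longleftrightarrow> e \<in> exps (Suc j) (a - 1) (d - int (Suc j))" for e
  proof -
    have "keys (e + s) = insert (Suc j) (keys e)"
      by (auto simp: in_keys_iff lookup_add lookup_s split: if_splits)
    moreover have "(\<Sum>i\<le>Suc j. lookup (e + s) i) = (\<Sum>i\<le>Suc j. lookup e i) + 1"
      by (simp add: lookup_add lookup_s sum.distrib)
    moreover have "(\<Sum>i\<le>Suc j. i * lookup (e + s) i) = (\<Sum>i\<le>Suc j. i * lookup e i) + Suc j"
      by (simp add: lookup_add lookup_s sum.distrib distrib_left)
    ultimately show ?thesis
      unfolding exps_def by (auto simp del: of_nat_sum sum.atMost_Suc)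
  qed
  have 2: "{e \<in> exps (Suc j) a d. lookup e (Suc j) \<noteq> 0}
    = (\<lambda>e. e + s) ` exps (Suc j) (a - 1) (d - int (Suc j))"
  proof (intro set_eqI iffI)
    fix e assume e: "e \<in> {e \<in> exps (Suc j) a d. lookup e (Suc j) \<noteq> 0}"
    then have eq: "e = (e - s) + s"
      using exponent_diff_single_eq_iff[of e "Suc j" "e - s"] unfolding s_def by simp
    have "e - s \<in> exps (Suc j) (a - 1) (d - int (Suc j))"
      using shift[of "e - s"] e unfolding eq[symmetric] by simp
    with eq show "e \<in> (\<lambda>e. e + s) ` exps (Suc j) (a - 1) (d - int (Suc j))" by (rule image_eqI)
  next
    fix e assume "e \<in> (\<lambda>e. e + s) ` exps (Suc j) (a - 1) (d - int (Suc j))"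
    then show "e \<in> {e \<in> exps (Suc j) a d. lookup e (Suc j) \<noteq> 0}"
      using shift by (auto simp: lookup_add lookup_s)
  qed
  have "card (exps (Suc j) a d) = card ({e \<in> exps (Suc j) a d. lookup e (Suc j) = 0}
      \<union> {e \<in> exps (Suc j) a d. lookup e (Suc j) \<noteq> 0})"
    by (rule arg_cong[of _ _ card]) blast
  also have "\<dots> = card {e \<in> exps (Suc j) a d. lookup e (Suc j) = 0}
      + card {e \<in> exps (Suc j) a d. lookup e (Suc j) \<noteq> 0}"
    by (rule card_Un_disjoint) (auto simp: finite_exps)
  also have "\<dots> = card (exps j a d) + card (exps (Suc j) (a - 1) (d - int (Suc j)))"
    unfolding 1 2 by (simp add: card_image inj_on_def)
  finally show ?thesis .
qed

lemma card_exps_0_left: "card (exps 0 (int a) d) = (if d = 0 then 1 else 0)"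
proof -
  have "e \<in> exps 0 (int a) d \<longleftrightarrow> e = single 0 a \<and> d = 0" for e
  proof
    assume e: "e \<in> exps 0 (int a) d"
    then have "lookup e i = lookup (single 0 a) i" for i
      by (cases "i = 0") (auto simp: exps_def lookup_single in_keys_iff subset_iff)
    then show "e = single 0 a \<and> d = 0"
      using e by (auto simp: exps_def intro: poly_mapping_eqI)
  qed (auto simp: exps_def)
  then have "exps 0 (int a) d = (if d = 0 then {single 0 a} else {})" by auto
  then show ?thesis by simp
qed

lemma card_exps_0_right: "card (exps j 0 d) = (if d = 0 then 1 else 0)"
proof (induction j arbitrary: d)
  case 0
  then show ?case using card_exps_0_left[of 0 d] by simp
next
  case (Suc j)
  then show ?case by (simp add: card_exps_Suc exps_neg)
qed

lemma q_binomial_eqI: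
  assumes "j \<le> n" "p * (q_prod j * q_prod (n - j)) = q_prod n"
  shows "q_binomial (int n) j = p"
  using q_binomial_mult[OF assms(1)] assms(2) q_prod_nonzero
  by (metis mult_cancel_right mult_eq_0_iff)

lemma q_binomial_0_right: "q_binomial (int n) 0 = 1"
  by (rule q_binomial_eqI) simp_all

lemma q_binomial_self: "q_binomial (int n) n = 1"
  by (rule q_binomial_eqI) simp_all

text \<open>After clearing denominators this is (1 - q^(j+1)) + q^(j+1) (1 - q^(a+1)) = 1 -
  q^(a+j+2).\<close>

lemma q_binomial_Pascal:
  "q_binomial (int (Suc a + Suc j)) (Suc j)
    = q_binomial (int (Suc a + j)) j + monom 1 (Suc j) * q_binomial (int (a + Suc j)) (Suc j)"
proof (rule q_binomial_eqI)
  let ?x = "monom 1 :: nat \<Rightarrow> int poly" and ?n = "Suc a + j"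
  have 1: "q_binomial (int ?n) j * (q_prod j * q_prod (Suc a)) = q_prod ?n"
    using q_binomial_mult[of j ?n] by simp
  have 2: "q_binomial (int (a + Suc j)) (Suc j) * (q_prod (Suc j) * q_prod a) = q_prod ?n"
    using q_binomial_mult[of "Suc j" ?n] by simp
  have "(q_binomial (int ?n) j + ?x (Suc j) * q_binomial (int (a + Suc j)) (Suc j)) * (q_prod (Suc j) * q_prod (Suc a))
    = q_binomial (int ?n) j * (q_prod j * q_prod (Suc a)) * (1 - ?x (Suc j))
      + ?x (Suc j) * (q_binomial (int (a + Suc j)) (Suc j) * (q_prod (Suc j) * q_prod a)) * (1 - ?x (Suc a))"
    by (simp only: q_prod_Suc[of j] q_prod_Suc[of a] distrib_left distrib_right ac_simps)
  also have "\<dots> = q_prod ?n * (1 - ?x (Suc j) * ?x (Suc a))"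
    unfolding 1 2 by (simp only: algebra_simps)
  also have "?x (Suc j) * ?x (Suc a) = ?x (Suc ?n)" by (simp add: mult_monom add.commute)
  also have "q_prod ?n * (1 - ?x (Suc ?n)) = q_prod (Suc a + Suc j)"
    using q_prod_Suc[of ?n] by simp
  finally show "(q_binomial (int ?n) j + ?x (Suc j) * q_binomial (int (a + Suc j)) (Suc j)) * (q_prod (Suc j) * q_prod (Suc a + Suc j - Suc j))
    = q_prod (Suc a + Suc j)" by simp
qed simp

text \<open>The monomials correspond to partitions of \<open>d\<close> into at most \<open>a\<close>
  parts of size at most \<open>j\<close>, with X_0 as padding. Both sides have the same recursion
  and boundary values.\<close>

lemma card_exps_eq_coeff:
  "int (card (exps j (int a) (int d))) = coeff (q_binomial (int (a + j)) j) d"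
proof (induction "a + j" arbitrary: a j d)
  case 0
  then show ?case using q_binomial_0_right[of 0] by (simp add: card_exps_0_right)
next
  case (Suc n)
  consider "a = 0" | "j = 0" | a' j' where "a = Suc a'" "j = Suc j'"
    by (metis not0_implies_Suc)
  then show ?case
  proof cases
    case 1
    then show ?thesis using q_binomial_self[of j] by (simp add: card_exps_0_right)
  next
    case 2
    then show ?thesis using q_binomial_0_right[of a] by (simp add: card_exps_0_left)
  next
    case 3
    have IH1: "int (card (exps j' (int a) (int d))) = coeff (q_binomial (int (Suc a' + j')) j') d"
      using Suc.hyps(1)[of a j' d] Suc.hyps(2) 3 by simp
    have IH2: "int (card (exps j (int a') (int d - int j))) = coeff (monom 1 j * q_binomial (int (a' + Suc j')) j) d"
    \<comment> \<open>For \<open>d < j\<close> the weight is negative and there are no monomials,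
      while the factor q^j makes the coefficient 0.\<close>
    proof (cases "d < j")
      case True
      then show ?thesis by (simp add: coeff_monom_mult exps_neg)
    next
      case False
      then show ?thesis using Suc.hyps(1)[of a' j "d - j"] Suc.hyps(2) 3
        by (simp add: coeff_monom_mult of_nat_diff)
    qed
    have "int (card (exps j (int a) (int d)))
      = int (card (exps j' (int a) (int d))) + int (card (exps j (int a') (int d - int j)))"
      using 3 card_exps_Suc[of j' "int a" "int d"] by simp
    also have "\<dots> = coeff (q_binomial (int (a + j)) j) d"
      unfolding IH1 IH2 unfolding 3 q_binomial_Pascal coeff_add ..
    finally show ?thesis .
  qed
qed

subsection \<open>Palindromic unimodal polynomials\<close>

text \<open>The centre c/2 is a parameter and not read off from the degree, so polynomials of
  different degrees, and 0, can share a centre and be added.\<close>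

definition palindromic :: "nat \<Rightarrow> int poly \<Rightarrow> bool" where
  "palindromic c p \<longleftrightarrow> (\<forall>i\<le>c. coeff p (c - i) = coeff p i) \<and> (\<forall>i>c. coeff p i = 0)"

lemma palindromicI:
  "(\<And>i. coeff p i = (if i \<le> c then coeff p (c - i) else 0)) \<Longrightarrow> palindromic c p"
  unfolding palindromic_def by (metis not_le)

lemma palindromicD:
  "palindromic c p \<Longrightarrow> coeff p i = (if i \<le> c then coeff p (c - i) else 0)"
  by (simp add: palindromic_def)

lemma palindromic_add: "palindromic c p \<Longrightarrow> palindromic c q \<Longrightarrow> palindromic c (p + q)"
  by (simp add: palindromic_def)

lemma palindromic_diff: "palindromic c p \<Longrightarrow> palindromic c q \<Longrightarrow> palindromic c (p - q)"
  by (simp add: palindromic_def)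

lemma palindromic_zero: "palindromic c 0"
  by (simp add: palindromic_def)

lemma palindromic_monom_mult:
  assumes "palindromic c p"
  shows "palindromic (c + 2 * e) (monom 1 e * p)"
proof (rule palindromicI)
  fix i
  consider "i < e" | "e \<le> i" "i \<le> c + e" | "c + e < i" "i \<le> c + 2 * e" | "c + 2 * e < i" by linarith
  then show "coeff (monom 1 e * p) i = (if i \<le> c + 2 * e then coeff (monom 1 e * p) (c + 2 * e - i) else 0)"
  proof cases
    case 1
    then have "coeff p (c + 2 * e - i - e) = 0"
      using palindromicD[OF assms, of "c + 2 * e - i - e"] by simp
    then show ?thesis using 1 by (simp add: coeff_monom_mult)
  next
    case 2
    then have "coeff p (i - e) = coeff p (c - (i - e))" "c + 2 * e - i - e = c - (i - e)"
      using palindromicD[OF assms, of "i - e"] by auto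
    then show ?thesis using 2 by (simp add: coeff_monom_mult)
  next
    case 3
    then have "coeff p (i - e) = 0" "c + 2 * e - i < e"
      using palindromicD[OF assms, of "i - e"] by auto
    then show ?thesis using 3 by (simp add: coeff_monom_mult)
  next
    case 4
    then have "coeff p (i - e) = 0"
      using palindromicD[OF assms, of "i - e"] by auto
    then show ?thesis using 4 by (simp add: coeff_monom_mult)
  qed
qed

section \<open>Palindromicity of q-binomial coefficients by reflection\<close>

lemma degree_one_minus_monom: "i > 0 \<Longrightarrow> degree (1 - monom 1 i :: int poly) = i"
  by (rule antisym) (simp_all add: degree_le le_degree)

lemma reflect_one_minus_monom:
  assumes "i > 0"
  shows "reflect_poly (1 - monom 1 i :: int poly) = - (1 - monom 1 i)"
  using assms by (intro poly_eqI) (auto simp: coeff_reflect_poly degree_one_minus_monom)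

lemma reflect_q_prod: "reflect_poly (q_prod n) = (-1) ^ n * q_prod n"
proof (induction n)
  case (Suc n)
  show ?case
    unfolding q_prod_Suc reflect_poly_mult Suc reflect_one_minus_monom[OF zero_less_Suc]
    by (simp add: algebra_simps)
qed simp

lemma degree_q_prod: "2 * degree (q_prod n) = n * (n + 1)"
proof (induction n)
  case (Suc n)
  have "degree (q_prod (Suc n)) = degree (q_prod n) + Suc n"
    unfolding q_prod_Suc using q_prod_nonzero[of n] q_prod_nonzero[of "Suc n"]
    by (subst degree_mult_eq) (auto simp: degree_one_minus_monom q_prod_Suc)
  then show ?case using Suc by simp
qed simp

text \<open>Reflection is multiplicative and multiplies \<open>q_prod n\<close> by (-1)^n, so the
  signs cancel in the quotient. Comparing degrees yields \<open>j * a\<close>.\<close>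

lemma palindromic_q_binomial: "palindromic (j * a) (q_binomial (int (a + j)) j)"
proof -
  define b where "b = q_binomial (int (a + j)) j"
  have b: "b * (q_prod j * q_prod a) = q_prod (a + j)"
    using q_binomial_mult[of j "a + j"] by (simp add: b_def)
  have "b \<noteq> 0" using b q_prod_nonzero[of "a + j"] by auto
  then have "degree (q_prod (a + j)) = degree b + (degree (q_prod j) + degree (q_prod a))"
    using q_prod_nonzero[of a] q_prod_nonzero[of j] unfolding b[symmetric] by (simp add: degree_mult_eq)
  then have "2 * degree b + (j * (j + 1) + a * (a + 1)) = (a + j) * (a + j + 1)"
    using degree_q_prod[of "a + j"] degree_q_prod[of a] degree_q_prod[of j] by linarith
  then have deg: "degree b = j * a" by (simp add: algebra_simps)
  have "reflect_poly b * ((-1) ^ j * q_prod j * ((-1) ^ a * q_prod a)) = (-1) ^ (a + j) * q_prod (a + j)"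
    unfolding reflect_q_prod[symmetric] reflect_poly_mult[symmetric] b ..
  then have "(-1) ^ (a + j) * (reflect_poly b * (q_prod j * q_prod a)) = (-1) ^ (a + j) * q_prod (a + j)"
    by (simp add: power_add mult_ac)
  then have "reflect_poly b * (q_prod j * q_prod a) = q_prod (a + j)" by simp
  then have "reflect_poly b = b"
    using q_binomial_eqI[of j "a + j" "reflect_poly b"] by (simp add: b_def)
  then have "coeff b i = (if i \<le> j * a then coeff b (j * a - i) else 0)" for i
    using coeff_reflect_poly[of b i] deg by (simp split: if_splits)
  then show ?thesis unfolding b_def by (rule palindromicI)
qed

text \<open>Fixing the centre makes the property stable under addition, unlike unimodality with an
  arbitrary peak. The decrease after the centre follows from palindromicity.\<close>

definition centered_unimodal :: "nat \<Rightarrow> int poly \<Rightarrow> bool" where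
  "centered_unimodal c p \<longleftrightarrow>
    palindromic c p \<and> nonneg_poly p \<and> (\<forall>i. 2 * i < c \<longrightarrow> coeff p i \<le> coeff p (Suc i))"

lemma centered_unimodal_add:
  "centered_unimodal c p \<Longrightarrow> centered_unimodal c q \<Longrightarrow> centered_unimodal c (p + q)"
  by (auto simp: centered_unimodal_def nonneg_poly_def palindromic_add intro: add_mono)

lemma centered_unimodal_monom_mult:
  assumes "centered_unimodal c p"
  shows "centered_unimodal (c + 2 * e) (monom 1 e * p)"
  unfolding centered_unimodal_def
proof (intro conjI allI impI)
  show "palindromic (c + 2 * e) (monom 1 e * p)"
    using assms by (simp add: centered_unimodal_def palindromic_monom_mult)
  show nonneg: "nonneg_poly (monom 1 e * p)"
    using assms by (simp add: centered_unimodal_def nonneg_poly_def coeff_monom_mult)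
  fix i assume i: "2 * i < c + 2 * e"
  show "coeff (monom 1 e * p) i \<le> coeff (monom 1 e * p) (Suc i)"
  proof (cases "i < e")
    case True
    then have "coeff (monom 1 e * p) i = 0" by (simp add: coeff_monom_mult)
    then show ?thesis using nonneg by (simp add: nonneg_poly_def)
  next
    case False
    then have "coeff p (i - e) \<le> coeff p (Suc (i - e))"
      using assms i by (auto simp: centered_unimodal_def)
    then show ?thesis using False by (simp add: coeff_monom_mult Suc_diff_le)
  qed
qed

text \<open>If the peak \<open>N\<close> is at most \<open>i\<close>, the coefficients decrease from
  \<open>Suc i\<close> to the mirror index \<open>c - i\<close>, whose coefficient equals that at
  \<open>i\<close>.\<close>

lemma centered_unimodalI:
  assumes pal: "palindromic c p" and "nonneg_poly p" "unimodal_poly p"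
  shows "centered_unimodal c p"
proof -
  obtain N where N: "mono_on {0..N} (coeff p)" "antimono_on {N..degree p} (coeff p)"
    using assms by (auto simp: unimodal_poly_def)
  have anti: "coeff p y \<le> coeff p x" if "N \<le> x" "x \<le> y" for x y
  proof (cases "y \<le> degree p")
    case True
    then show ?thesis using N(2) that by (auto simp: monotone_on_def)
  next
    case False
    then show ?thesis using assms by (simp add: coeff_eq_0 nonneg_poly_def)
  qed
  have "coeff p i \<le> coeff p (Suc i)" if "2 * i < c" for i
  proof (cases "Suc i \<le> N")
    case True
    then show ?thesis using N(1) by (auto simp: monotone_on_def)
  next
    case False
    have "coeff p (c - i) = coeff p i"
      using palindromicD[OF pal, of i] that by simp
    then show ?thesis using anti[of "Suc i" "c - i"] False that by simp
  qed
  then show ?thesis using assms by (simp add: centered_unimodal_def)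
qed

lemma centered_unimodalD:
  assumes "centered_unimodal c p"
  shows "nonneg_poly p \<and> unimodal_poly p"
proof
  show "nonneg_poly p" using assms by (simp add: centered_unimodal_def)
  have pal: "coeff p (c - i) = coeff p i" if "i \<le> c" for i
    using assms that by (auto simp: centered_unimodal_def palindromic_def)
  have high: "coeff p i = 0" if "i > c" for i
    using assms that by (auto simp: centered_unimodal_def palindromic_def)
  have nonneg: "coeff p i \<ge> 0" for i
    using assms by (simp add: centered_unimodal_def nonneg_poly_def)
  \<comment> \<open>The bound is c/2 rounded up, because \<open>down\<close> applies it to mirror
    images \<open>c - x\<close> of indices \<open>x \<ge> c div 2\<close>.\<close>
  have up: "coeff p x \<le> coeff p y" if "x \<le> y" "y \<le> (c + 1) div 2" for x y
    using that
  proof (induction rule: dec_induct)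
    case (step n)
    then have "coeff p n \<le> coeff p (Suc n)" using assms by (simp add: centered_unimodal_def)
    then show ?case using step by simp
  qed simp
  have down: "coeff p y \<le> coeff p x" if "c div 2 \<le> x" "x \<le> y" for x y
  proof (cases "y \<le> c")
    case True
    then show ?thesis using pal[of x] pal[of y] up[of "c - y" "c - x"] that by simp
  next
    case False
    then show ?thesis using high nonneg by simp
  qed
  show "unimodal_poly p"
    unfolding unimodal_poly_def
  \<comment> \<open>The minimum keeps the peak within the degree. It differs from
    \<open>c div 2\<close> only for \<open>p = 0\<close>, as a nonzero palindromic polynomial
    reaches its centre.\<close>
  proof (intro exI[of _ "min (c div 2) (degree p)"] conjI)
    show "mono_on {0..min (c div 2) (degree p)} (coeff p)"
      by (rule monotone_onI) (auto intro!: up)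
    show "antimono_on {min (c div 2) (degree p)..degree p} (coeff p)"
    proof (rule monotone_onI)
      fix x y assume "x \<in> {min (c div 2) (degree p)..degree p}" "y \<in> {min (c div 2) (degree p)..degree p}" "x \<le> y"
      then show "coeff p y \<le> coeff p x"
        using down[of x y] by (cases "c div 2 \<le> degree p") auto
    qed
  qed simp
qed

subsection \<open>Differences of q-binomial coefficients\<close>

text \<open>The coefficients are weight space dimensions of the quotient by an invariant, hence grow
  up to the centre by \<open>card_exps_diff_mono\<close>.\<close>

lemma q_binomial_diff_centered_unimodal:
  assumes j: "j \<ge> 2" and b: "b \<ge> int j"
  shows "centered_unimodal (j * nat (b - int j))
    (q_binomial b j - monom 1 (j * (j - 1)) * q_binomial (b - 2 * (int j - 1)) j)"
proof -
  define a where "a = nat (b - int j)"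
  have ba: "b = int (a + j)" using b by (simp add: a_def)
  define n w where "n = 2 * (j - 1)" and "w = j * (j - 1)"
  have nw: "int n = 2 * (int j - 1)" "int w = int j * (int j - 1)" "2 * w = j * n" "w > 0"
    using j by (auto simp: n_def w_def of_nat_diff)
  define G where "G = q_binomial b j - monom 1 w * q_binomial (b - 2 * (int j - 1)) j"
  have coeff2: "coeff (monom 1 w * q_binomial (b - 2 * (int j - 1)) j) d
    = int (card (exps j (int a - int n) (int d - int w)))" for d
  \<comment> \<open>For \<open>a < n\<close> both sides are 0: the q-binomial by convention, the
    count because no monomial has negative degree.\<close>
  proof (cases "n \<le> a \<and> w \<le> d")
    case True
    then have eq: "b - 2 * (int j - 1) = int (a - n + j)" using nw ba by (simp add: of_nat_diff)
    show ?thesis unfolding eq using True card_exps_eq_coeff[of j "a - n" "d - w"]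
      by (simp add: coeff_monom_mult of_nat_diff)
  next
    case False
    then consider "a < n" | "d < w" by linarith
    then show ?thesis
    proof cases
      case 1
      then have "b - 2 * (int j - 1) < int j" using nw ba by simp
      then show ?thesis using 1 by (simp add: q_binomial_def exps_neg)
    qed (simp add: coeff_monom_mult exps_neg)
  qed
  have coeffG: "coeff G d
    = int (card (exps j (int a) (int d))) - int (card (exps j (int a - int n) (int d - int w)))" for d
    unfolding G_def coeff_diff coeff2 by (simp add: ba card_exps_eq_coeff)
  obtain D where D: "D \<noteq> 0" "sl2_invariant j (int n) (int w) D"
    using invariant_of_discriminant_degree_exists[OF j] nw by auto
  have mono: "coeff G d \<le> coeff G (Suc d)" if "2 * d < j * a" for d
  proof -
    have "2 * int d < int j * int a" using that by (metis of_nat_less_iff of_nat_mult of_nat_numeral)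
    from card_exps_diff_mono[OF D(2,1) this] show ?thesis
      unfolding coeffG by (simp add: add.commute)
  qed
  have pal: "palindromic (j * a) G"
    unfolding G_def
  proof (rule palindromic_diff)
    show "palindromic (j * a) (q_binomial b j)" unfolding ba by (rule palindromic_q_binomial)
    show "palindromic (j * a) (monom 1 w * q_binomial (b - 2 * (int j - 1)) j)"
    proof (cases "n \<le> a")
      case True
      then have eq: "b - 2 * (int j - 1) = int (a - n + j)" using nw ba by (simp add: of_nat_diff)
      have "j * a = j * (a - n) + 2 * w" using nw True by (simp add: diff_mult_distrib2)
      then show ?thesis
        unfolding eq by (simp only: palindromic_monom_mult palindromic_q_binomial)
    next
      case False
      then have "b - 2 * (int j - 1) < int j" using nw ba by simp
      then show ?thesis by (simp add: q_binomial_def palindromic_zero)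
    qed
  qed
  \<comment> \<open>The subtracted polynomial starts at q^w with \<open>w > 0\<close>, so the
    coefficient at 0 is a plain count; \<open>mono\<close> carries nonnegativity to the
    centre.\<close>
  have low: "0 \<le> coeff G d" if "2 * d \<le> j * a + 1" for d
    using that
  proof (induction d)
    case 0
    then show ?case using nw by (simp add: coeffG exps_neg)
  next
    case (Suc d)
    then show ?case using mono[of d] by simp
  qed
  have "nonneg_poly G"
    unfolding nonneg_poly_def
  proof
    fix d
    show "0 \<le> coeff G d"
    proof (cases "2 * d \<le> j * a")
      case True
      then show ?thesis by (intro low) simp
    next
      case False
      then have "0 \<le> coeff G (j * a - d)" by (intro low) simp
      then show ?thesis using palindromicD[OF pal, of d] by simp
    qed
  qed
  then have "centered_unimodal (j * a) G"
    using pal mono by (simp add: centered_unimodal_def)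
  then show ?thesis by (simp add: G_def a_def w_def)
qed

theorem theorem2p3:
  fixes k m :: nat and b :: int
  assumes "k \<ge> 4"
    and "m \<ge> k"
    and "int k - 2 \<le> b"
    and "real_of_int b \<le> (real k * real m - 4 * real k + 4) / (real k - 2)"
    and "even (int k * (int m - b))"
    and "nonneg_poly (f_poly k m b)"
    and "unimodal_poly (f_poly k m b)"
  shows "nonneg_poly (f_poly k m (b - (2 * int k - 6))) \<and>
         unimodal_poly (f_poly k m (b - (2 * int k - 6)))"
proof -
  define j where "j = k - 2"
  define b' where "b' = b - 2 * (int j - 1)"
  have j: "j \<ge> 2" "int k = int j + 2" "k = j + 2" using assms(1) by (auto simp: j_def)
  have b'_eq: "b - (2 * int k - 6) = b'" using j by (simp add: b'_def)
  define e where "e = nat (int k * (int m - b) div 2 + b - 2 * int k + 2)"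
  have bound: "int j * b \<le> int k * int m - 4 * int k + 4"
  proof -
    have "real_of_int b * real j \<le> real k * real m - 4 * real k + 4"
      using assms(4) j by (simp add: pos_le_divide_eq)
    then have "real_of_int (int j * b) \<le> real_of_int (int k * int m - 4 * int k + 4)"
      by (simp add: mult.commute)
    then show ?thesis by (simp only: of_int_le_iff)
  qed
  obtain r where r: "int k * (int m - b) = 2 * r" using assms(5) by (elim evenE)
  have e_int: "int e = r + b - 2 * int k + 2"
  proof -
    \<comment> \<open>The left side is km - (k-2)b - 4k + 4, so the upper bound on \<open>b\<close>
      says exactly that the exponent is nonnegative.\<close>
    have "2 * (r + b - 2 * int k + 2) \<ge> 0"
      using bound j r by (simp add: algebra_simps)
    then show ?thesis unfolding e_def r by simp
  qed
  \<comment> \<open>Lowering \<open>b\<close> by 2(j-1) adds k(j-1) to the halved product and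
    subtracts 2(j-1), in total adding j(j-1).\<close>
  have e': "nat (int k * (int m - b') div 2 + b' - 2 * int k + 2) = e + j * (j - 1)"
  proof -
    have "int k * (int m - b') = 2 * (r + int k * (int j - 1))"
      using r by (simp add: b'_def algebra_simps)
    then have "int k * (int m - b') div 2 + b' - 2 * int k + 2 = r + int k * (int j - 1) + b' - 2 * int k + 2"
      by simp
    also have "\<dots> = int e + int j * (int j - 1)"
      using e_int j by (simp add: b'_def algebra_simps)
    also have "\<dots> = int (e + j * (j - 1))"
      using j by (simp add: of_nat_diff)
    finally show ?thesis by (simp only: nat_int)
  qed
  define G where "G = q_binomial b j - monom 1 (j * (j - 1)) * q_binomial b' j"
  have f_eq: "f_poly k m b' = f_poly k m b + monom 1 e * G"
  proof -
    have "monom 1 (e + j * (j - 1)) = monom 1 e * (monom 1 (j * (j - 1)) :: int poly)"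
      by (simp add: mult_monom)
    then show ?thesis
      unfolding f_poly_def e' e_def[symmetric] j_def[symmetric] G_def
      by (simp add: algebra_simps)
  qed
  have bj: "b \<ge> int j" using assms(3) j by simp
  define a where "a = nat (b - int j)"
  have a: "int a = b - int j" using bj by (simp add: a_def)
  \<comment> \<open>This gives \<open>f_poly k m b\<close> and \<open>monom 1 e * G\<close> the same
    centre, so that their sum remains unimodal.\<close>
  have center: "k * (m - k) = j * a + 2 * e"
  proof -
    have "(int j + 2) * (int m - b) = 2 * r" using r j(2) by simp
    then have "int k * (int m - int k) = int j * int a + 2 * int e"
      unfolding e_int a j(2) by (simp add: algebra_simps)
    moreover have "int (k * (m - k)) = int k * (int m - int k)"
      using assms(2) by (simp add: of_nat_diff)
    ultimately have "int (k * (m - k)) = int (j * a + 2 * e)" by simp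
    then show ?thesis by (simp only: of_nat_eq_iff)
  qed
  have "palindromic (k * (m - k)) (f_poly k m b)"
    unfolding f_poly_def e_def[symmetric] j_def[symmetric]
  proof (rule palindromic_diff)
    show "palindromic (k * (m - k)) (q_binomial (int m) k)"
      using palindromic_q_binomial[of k "m - k"] assms(2) by simp
    show "palindromic (k * (m - k)) (monom 1 e * q_binomial b j)"
      using palindromic_monom_mult[OF palindromic_q_binomial[of j a], of e] a center by simp
  qed
  then have "centered_unimodal (k * (m - k)) (f_poly k m b)"
    using assms(6,7) by (rule centered_unimodalI)
  moreover have "centered_unimodal (k * (m - k)) (monom 1 e * G)"
    unfolding center G_def a_def b'_def
    by (intro centered_unimodal_monom_mult q_binomial_diff_centered_unimodal j bj)
  ultimately have "centered_unimodal (k * (m - k)) (f_poly k m b')"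
    unfolding f_eq by (rule centered_unimodal_add)
  then show ?thesis unfolding b'_eq by (rule centered_unimodalD)
qed

end
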